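(* Let $\mu$ be a probability measure on a set $\mathcal{X}$ and let $k:\mathcal{X}\times\mathcal{X}\to\mathbb{R}$ be a positive-definite kernel with real RKHS $\mathcal{H}$, such that $\kappa:=\sup_{x\in\mathcal{X}}\sqrt{k(x,x)}<\infty$ and $k$ admits a Mercer expansion $k(x,y)=\sum_{j=1}^\infty \sigma_j e_j(x)e_j(y)$ for all $x,y\in\mathcal{X}$, where $(e_j)_{j\ge1}$ is an orthonormal set in $L^2(\mu)$ and $\sigma_1\ge\sigma_2\ge\cdots\ge0$. Let $N,d$ be positive integers with $6(d+1)\le N$, let $x_1,\dots,x_N\sim\mu$ be independent, and set $n_d:=\lfloor N/(6(d+1))\rfloor$. Then, with probability at least $1-2^{-(d+1)}$, there exist weights $(w_i)_{i=1}^N\in\Delta_N$ such that the quadrature rule $Q_N(f)=\sum_{i=1}^N w_if(x_i)$ satisfies \[ \operatorname{wce}(Q_N;\mathcal{H},\mu)\le 2\sqrt{\sum_{j>d}\sigma_j}+\frac{4\kappa}{n_d}. \]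
   Context: $\Delta_N:=\{\bm w\in\mathbb{R}^N_{\ge0}:\sum_{i=1}^N w_i=1\}$. For a quadrature rule $Q_N(f)=\sum_i w_i f(x_i)$, the worst-case error is $\operatorname{wce}(Q_N;\mathcal{H},\mu):=\sup_{\|f\|_{\mathcal{H}}\le1}\bigl|\int f\,\mathrm{d}\mu-Q_N(f)\bigr|=\bigl\|m_\mu-\sum_{i}w_ik(x_i,\cdot)\bigr\|_{\mathcal{H}}$, where $m_\mu:=\int k(x,\cdot)\,\mathrm{d}\mu(x)\in\mathcal{H}$ is the kernel mean embedding. *)

theory Defs
  imports "HOL-Probability.Probability"
begin

text \<open>The RKHS H of k is represented through a Hilbert space type 'h and a
feature map Phi with k x y = Phi x \<bullet> Phi y and Phi(X) spanning a dense subspace;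
then h \<mapsto> (\<lambda>x. h \<bullet> Phi x) is an isometric isomorphism from 'h onto H.\<close>

definition prob_simplex :: "nat \<Rightarrow> (nat \<Rightarrow> real) set" where
  "prob_simplex N = {w. (\<forall>i<N. 0 \<le> w i) \<and> (\<Sum>i<N. w i) = 1}"

definition wce :: "'a measure \<Rightarrow> ('a \<Rightarrow> 'h::real_inner) \<Rightarrow> nat \<Rightarrow> (nat \<Rightarrow> 'a) \<Rightarrow> (nat \<Rightarrow> real) \<Rightarrow> real" where
  "wce M Phi N x w =
     (SUP h \<in> {h. norm h \<le> 1}.
        \<bar>(\<integral>z. h \<bullet> Phi z \<partial>M) - (\<Sum>i<N. w i * (h \<bullet> Phi (x i)))\<bar>)"

end

theory Submission
  imports Defs
begin

text \<open>Map each sample point to \<open>D = d + 1\<close> real coordinates: its first \<open>d\<close> Mercer coordinates and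
  the norm of the remaining ones, centred at the mean. By Cauchy--Schwarz, weights whose convex
  combination of these vectors has norm \<open>\<eta>\<close> give a quadrature rule with worst-case error at most
  \<open>2 * sqrt (\<Sum>j. \<sigma> (j + d)) + \<eta>\<close>. So consider the point \<open>u\<close> of least norm in the convex hull of the sample
  and suppose \<open>norm u > \<eta> = 4 * \<kappa> / n\<close>. A fresh point lies on the origin's side of the hyperplane
  supporting the hull at \<open>u\<close> (it violates \<open>u\<close>) with probability at least \<open>\<alpha> = \<eta> / (2 * \<kappa> + \<eta>)\<close>, because the
  coordinates have mean zero and norm at most \<open>2 * \<kappa>\<close>. On the other hand \<open>u\<close> is determined by at most
  \<open>D\<close> points, so by Clarkson--Shor sampling at most \<open>1 / (q ^ D * (1 - q) ^ k)\<close> of the \<open>k\<close>-subsets of \<open>N + k\<close>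
  points consist entirely of violators of the other \<open>N\<close>. Comparing the two bounds for \<open>k = 2 * D\<close>
  controls the failure probability without a factor logarithmic in \<open>n\<close> and without any general
  position assumption.\<close>

section \<open>The point of least norm in a finitely generated convex hull\<close>

text \<open>Vectors are functions on \<open>nat\<close> of which only the first \<open>D\<close>
  coordinates count, so that the dimension is a term and can be taken to be
  \<open>Suc d\<close>.\<close>

definition dot :: "nat \<Rightarrow> (nat \<Rightarrow> real) \<Rightarrow> (nat \<Rightarrow> real) \<Rightarrow> real" where
  "dot D a b = (\<Sum>l<D. a l * b l)"

definition simplex_weights :: "'i set \<Rightarrow> ('i \<Rightarrow> real) set" where
  "simplex_weights I = {w. (\<forall>i\<in>I. 0 \<le> w i) \<and> sum w I = 1}"

definition comb :: "('i \<Rightarrow> nat \<Rightarrow> real) \<Rightarrow> 'i set \<Rightarrow> ('i \<Rightarrow> real) \<Rightarrow> nat \<Rightarrow> real" where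
  "comb z I w l = (\<Sum>i\<in>I. w i * z i l)"

text \<open>The squared distance from the origin to a convex hull. It takes an index set instead of
  a set of points, so sample points that coincide stay distinct in the counting argument.\<close>

definition hull_dist2 :: "nat \<Rightarrow> ('i \<Rightarrow> nat \<Rightarrow> real) \<Rightarrow> 'i set \<Rightarrow> real" where
  "hull_dist2 D z I = (INF w\<in>simplex_weights I. dot D (comb z I w) (comb z I w))"

definition nearest_weights :: "nat \<Rightarrow> ('i \<Rightarrow> nat \<Rightarrow> real) \<Rightarrow> 'i set \<Rightarrow> ('i \<Rightarrow> real) \<Rightarrow> bool" where
  "nearest_weights D z I w \<longleftrightarrow>
     w \<in> simplex_weights I \<and> dot D (comb z I w) (comb z I w) = hull_dist2 D z I"

lemma dot_self_nonneg: "0 \<le> dot D a a"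
  by (simp add: dot_def sum_nonneg)

lemma dot_comb_right: "dot D a (comb z I w) = (\<Sum>i\<in>I. w i * dot D a (z i))"
proof -
  have "dot D a (comb z I w) = (\<Sum>l<D. \<Sum>i\<in>I. w i * (a l * z i l))"
    unfolding dot_def comb_def sum_distrib_left
    by (intro sum.cong refl) (simp add: mult_ac)
  also have "\<dots> = (\<Sum>i\<in>I. \<Sum>l<D. w i * (a l * z i l))"
    by (rule sum.swap)
  also have "\<dots> = (\<Sum>i\<in>I. w i * dot D a (z i))"
    by (simp add: dot_def sum_distrib_left)
  finally show ?thesis .
qed

lemma dot_Cauchy_Schwarz: "(dot D a b)\<^sup>2 \<le> dot D a a * dot D b b"
  using Cauchy_Schwarz_ineq_sum[of a b "{..<D}"] by (simp add: dot_def power2_eq_square)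

lemma abs_dot_le: "\<bar>dot D a b\<bar> \<le> sqrt (dot D a a) * sqrt (dot D b b)"
  using real_sqrt_le_mono[OF dot_Cauchy_Schwarz[of D a b]] by (simp add: real_sqrt_mult)

lemma hull_dist2_bdd: "bdd_below ((\<lambda>w. dot D (comb z I w) (comb z I w)) ` simplex_weights I)"
  by (rule bdd_belowI2[where m = 0]) (rule dot_self_nonneg)

lemma hull_dist2_le:
  "w \<in> simplex_weights I \<Longrightarrow> hull_dist2 D z I \<le> dot D (comb z I w) (comb z I w)"
  unfolding hull_dist2_def by (rule cINF_lower[OF hull_dist2_bdd])

lemma unit_weight_mem:
  "finite I \<Longrightarrow> i \<in> I \<Longrightarrow> (\<lambda>j. if j = i then 1 else 0) \<in> simplex_weights I"
  by (auto simp: simplex_weights_def)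

lemma comb_unit_weight:
  "finite I \<Longrightarrow> i \<in> I \<Longrightarrow> comb z I (\<lambda>j. if j = i then 1 else 0) = z i"
  by (rule ext) (simp add: comb_def if_distrib[where f = "\<lambda>x. x * _"] cong: if_cong)

lemma nearest_weights_exist:
  fixes I :: "'i set"
  assumes "finite I" "I \<noteq> {}"
  shows "\<exists>w. nearest_weights D z I w"
proof -
  \<comment> \<open>\<open>simplex_weights I\<close> leaves weights outside \<open>I\<close> free.
    Pinning them to 0 makes the simplex a closed part of a compact product.\<close>
  define B :: "('i \<Rightarrow> real) set" where "B = PiE UNIV (\<lambda>i. if i \<in> I then {0..1} else {0})"
  define C where "C = B \<inter> {w. sum w I = 1}"
  define Q where "Q w = dot D (comb z I w) (comb z I w)" for w
  have "compactin (product_topology (\<lambda>_. euclidean) UNIV) B"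
    unfolding B_def by (auto simp: compactin_PiE)
  then have "compact B"
    by (simp add: euclidean_product_topology)
  moreover have "closed {w. sum w I = (1::real)}"
    by (intro closed_Collect_eq continuous_intros continuous_on_product_coordinates)
  ultimately have "compact C"
    unfolding C_def by (rule compact_Int_closed)
  obtain i where i: "i \<in> I" using assms by blast
  have "(\<lambda>j. if j = i then 1 else 0) \<in> C"
    using i assms by (auto simp: C_def B_def split: if_splits)
  then have "C \<noteq> {}" by blast
  moreover have "continuous_on C Q"
    unfolding Q_def dot_def comb_def
    by (intro continuous_intros continuous_on_subset[OF continuous_on_product_coordinates]) auto
  ultimately obtain w where w: "w \<in> C" "\<And>v. v \<in> C \<Longrightarrow> Q w \<le> Q v"
    using continuous_attains_inf[OF \<open>compact C\<close>] by blast
  have wS: "w \<in> simplex_weights I"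
    using w(1) by (force simp: C_def B_def simplex_weights_def split: if_splits)
  have "Q w \<le> Q v" if v: "v \<in> simplex_weights I" for v
  proof -
    define u where "u j = (if j \<in> I then v j else 0)" for j
    have "v j \<le> 1" if "j \<in> I" for j
      using v member_le_sum[of j I v] that assms(1) by (auto simp: simplex_weights_def)
    then have "u \<in> C"
      using v by (auto simp: C_def B_def u_def simplex_weights_def)
    moreover have "comb z I u = comb z I v"
      by (rule ext) (simp add: comb_def u_def)
    ultimately show ?thesis
      using w(2)[of u] by (simp add: Q_def)
  qed
  then have "Q w \<le> hull_dist2 D z I"
    unfolding hull_dist2_def Q_def using wS by (intro cINF_greatest) auto
  with wS hull_dist2_le[OF wS, of D z] show ?thesis
    by (auto simp: nearest_weights_def Q_def)
qed

lemma zero_extend_simplex_weights: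
  assumes "w \<in> simplex_weights I" "I \<subseteq> S" "finite S"
  defines "u \<equiv> \<lambda>i. if i \<in> I then w i else 0"
  shows "u \<in> simplex_weights S" "comb z S u = comb z I w"
proof -
  have *: "S \<inter> I = I" using assms(2) by blast
  show "u \<in> simplex_weights S"
    using assms(1,3) by (auto simp: simplex_weights_def u_def sum.If_cases *)
  show "comb z S u = comb z I w"
    using assms(3) by (intro ext)
      (simp add: comb_def u_def if_distrib[where f = "\<lambda>x. x * _"] sum.If_cases * cong: if_cong)
qed

lemma hull_dist2_antimono:
  assumes "I \<subseteq> S" "finite S" "I \<noteq> {}"
  shows "hull_dist2 D z S \<le> hull_dist2 D z I"
proof -
  obtain w where w: "nearest_weights D z I w"
    using nearest_weights_exist assms by (metis finite_subset)
  then show ?thesis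
    using hull_dist2_le[OF zero_extend_simplex_weights(1)[of w I S], of D z]
      zero_extend_simplex_weights(2)[of w I S z] assms
    by (simp add: nearest_weights_def)
qed

lemma nearest_weights_zero_extend:
  assumes "nearest_weights D z I w" "I \<subseteq> S" "finite S" "hull_dist2 D z S = hull_dist2 D z I"
  defines "u \<equiv> \<lambda>i. if i \<in> I then w i else 0"
  shows "nearest_weights D z S u" "comb z S u = comb z I w"
  using assms(1,4) zero_extend_simplex_weights[of w I S, OF _ assms(2,3)]
  by (simp_all add: nearest_weights_def u_def)

section \<open>Optimality of the nearest point, and violators\<close>

lemma dot_segment:
  assumes "dot D r p < dot D r r"
  shows "\<exists>s. 0 < s \<and> s \<le> 1 \<and>
    dot D (\<lambda>l. (1 - s) * r l + s * p l) (\<lambda>l. (1 - s) * r l + s * p l) < dot D r r"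
proof -
  define g where "g = dot D r r - dot D r p"
  define Q where "Q = dot D (\<lambda>l. p l - r l) (\<lambda>l. p l - r l)"
  \<comment> \<open>Along the segment the squared norm is
    \<open>dot D r r - 2 * s * g + s * (s * Q)\<close>; this \<open>s\<close> gives
    \<open>s * Q \<le> g\<close>, so the linear gain wins. The \<open>+ 1\<close> avoids division by
    zero.\<close>
  define s where "s = min 1 (g / (Q + 1))"
  have g: "0 < g" using assms by (simp add: g_def)
  have Q: "0 \<le> Q" by (simp add: Q_def dot_self_nonneg)
  have s: "0 < s" "s \<le> 1" using g Q by (auto simp: s_def)
  have "s * Q \<le> g / (Q + 1) * Q" using Q by (intro mult_right_mono) (auto simp: s_def)
  also have "\<dots> \<le> g" using g Q by (simp add: field_simps)
  finally have sQ: "s * Q \<le> g" .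
  have "dot D (\<lambda>l. (1 - s) * r l + s * p l) (\<lambda>l. (1 - s) * r l + s * p l)
      = dot D r r - 2 * s * g + s * (s * Q)"
    unfolding g_def Q_def dot_def sum_subtractf[symmetric] sum_distrib_left sum.distrib[symmetric]
    by (intro sum.cong refl) (simp add: algebra_simps)
  also have "\<dots> \<le> dot D r r - 2 * s * g + s * g"
    using sQ s by (intro add_left_mono mult_left_mono) auto
  also have "\<dots> < dot D r r" using s g by simp
  finally show ?thesis using s by blast
qed

text \<open>First-order optimality: a point on the origin's side of the supporting hyperplane would,
  by \<open>dot_segment\<close>, give a shorter vector on a segment that stays inside the
  hull.\<close>

lemma nearest_weights_dot_ge:
  assumes w: "nearest_weights D z I w" and i: "i \<in> I" and fin: "finite I"
  shows "hull_dist2 D z I \<le> dot D (comb z I w) (z i)"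
proof (rule ccontr)
  define r where "r = comb z I w"
  have rr: "dot D r r = hull_dist2 D z I" using w by (simp add: nearest_weights_def r_def)
  assume "\<not> ?thesis"
  then have "dot D r (z i) < dot D r r" unfolding rr by (simp add: r_def)
  then obtain s where s: "0 < s" "s \<le> 1"
    and lt: "dot D (\<lambda>l. (1 - s) * r l + s * z i l) (\<lambda>l. (1 - s) * r l + s * z i l) < dot D r r"
    using dot_segment by blast
  define e where "e = (\<lambda>j. if j = i then 1 else (0::real))"
  define u where "u j = (1 - s) * w j + s * e j" for j
  have e: "e \<in> simplex_weights I" "comb z I e = z i"
    using unit_weight_mem[OF fin i] comb_unit_weight[OF fin i] by (simp_all add: e_def)
  have "u \<in> simplex_weights I"
    using w e(1) s
    by (auto simp: nearest_weights_def simplex_weights_def u_def sum.distrib sum_distrib_left[symmetric])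
  moreover have "comb z I u = (\<lambda>l. (1 - s) * r l + s * z i l)"
    unfolding e(2)[symmetric] r_def
    by (rule ext) (simp add: comb_def u_def sum_distrib_left sum.distrib[symmetric] algebra_simps)
  ultimately show False
    using hull_dist2_le[of u I D z] lt rr by simp
qed

text \<open>This turns a drop in distance into a half-space condition on the new point alone, to
  which a probability can be assigned. If the distance does not drop, the old minimiser stays
  optimal and first-order optimality holds at the new point. Conversely, if every point satisfies
  the hyperplane inequality, so does the whole enlarged hull, which is then no closer to the
  origin.\<close>

lemma nearest_weights_violated:
  assumes w: "nearest_weights D z I w" and fin: "finite I" and ne: "I \<noteq> {}"
  shows "hull_dist2 D z (insert i I) < hull_dist2 D z I \<longleftrightarrow> dot D (comb z I w) (z i) < hull_dist2 D z I"
proof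
  define r where "r = comb z I w"
  have rr: "dot D r r = hull_dist2 D z I" using w by (simp add: nearest_weights_def r_def)
  show "hull_dist2 D z (insert i I) < hull_dist2 D z I" if lt: "dot D (comb z I w) (z i) < hull_dist2 D z I"
  proof (rule ccontr)
    assume "\<not> ?thesis"
    then have eq: "hull_dist2 D z (insert i I) = hull_dist2 D z I"
      using hull_dist2_antimono[of I "insert i I" D z] fin ne by auto
    show False
      using nearest_weights_dot_ge[OF nearest_weights_zero_extend(1)[OF w _ _ eq], of i]
        nearest_weights_zero_extend(2)[OF w _ _ eq] fin lt eq by auto
  qed
  show "dot D (comb z I w) (z i) < hull_dist2 D z I" if lt: "hull_dist2 D z (insert i I) < hull_dist2 D z I"
  proof (rule ccontr)
    assume "\<not> ?thesis"
    then have ge: "dot D r r \<le> dot D r (z j)" if "j \<in> insert i I" for j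
      using that nearest_weights_dot_ge[OF w _ fin, of j] unfolding rr by (auto simp: r_def)
    obtain v where v: "nearest_weights D z (insert i I) v"
      using nearest_weights_exist[of "insert i I"] fin by auto
    define p where "p = comb z (insert i I) v"
    have vs: "\<forall>j\<in>insert i I. 0 \<le> v j" "sum v (insert i I) = 1"
      using v by (auto simp: nearest_weights_def simplex_weights_def)
    have "dot D r r = (\<Sum>j\<in>insert i I. v j * dot D r r)"
      by (simp only: sum_distrib_right[symmetric] vs mult_1)
    also have "\<dots> \<le> (\<Sum>j\<in>insert i I. v j * dot D r (z j))"
      using vs ge by (intro sum_mono mult_left_mono) auto
    also have "\<dots> = dot D r p" by (simp only: p_def dot_comb_right)
    finally have "dot D r r \<le> dot D r p" .
    \<comment> \<open>Expanding this square gives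
      \<open>dot D p p \<ge> 2 * dot D r p - dot D r r\<close>, which is at least
      \<open>dot D r r\<close>.\<close>
    moreover have "0 \<le> dot D (\<lambda>l. r l - p l) (\<lambda>l. r l - p l)" by (rule dot_self_nonneg)
    moreover have "dot D (\<lambda>l. r l - p l) (\<lambda>l. r l - p l) = dot D r r - 2 * dot D r p + dot D p p"
      unfolding dot_def sum_subtractf[symmetric] sum_distrib_left sum.distrib[symmetric]
      by (intro sum.cong refl) (simp add: algebra_simps)
    ultimately have "dot D r r \<le> dot D p p" by linarith
    then show False using lt v by (simp add: rr p_def nearest_weights_def)
  qed
qed

text \<open>At equal distances the nearest weights for \<open>R\<close>, extended by zero, are
  nearest for \<open>S\<close> too. Both sets then share a nearest point and its supporting
  half-space.\<close>

lemma violated_iff_violated_superset: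
  assumes "R \<subseteq> S" "finite S" "R \<noteq> {}" "hull_dist2 D z S = hull_dist2 D z R"
  shows "hull_dist2 D z (insert i S) < hull_dist2 D z S \<longleftrightarrow>
         hull_dist2 D z (insert i R) < hull_dist2 D z R"
proof -
  have finR: "finite R" using assms finite_subset by blast
  obtain w where w: "nearest_weights D z R w"
    using nearest_weights_exist[OF finR assms(3)] by blast
  show ?thesis
    using nearest_weights_violated[OF w finR assms(3), of i] assms
      nearest_weights_violated[OF nearest_weights_zero_extend(1)[OF w assms(1,2,4)], of i]
      nearest_weights_zero_extend(2)[OF w assms(1,2,4)] by auto
qed

section \<open>How many points determine the nearest point\<close>

lemma exists_linear_relation:
  fixes z :: "'i \<Rightarrow> nat \<Rightarrow> real"
  assumes "finite I" "D < card I"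
  shows "\<exists>c. (\<exists>i\<in>I. c i \<noteq> 0) \<and> (\<forall>l<D. (\<Sum>i\<in>I. c i * z i l) = 0)"
  using assms
proof (induction D arbitrary: I z)
  case 0
  then obtain i where "i \<in> I" by (metis all_not_in_conv card.empty less_irrefl)
  then show ?case by (intro exI[of _ "\<lambda>_. 1"]) auto
next
  case (Suc D)
  show ?case
  proof (cases "\<forall>i\<in>I. z i D = 0")
    case True
    obtain c where "\<exists>i\<in>I. c i \<noteq> 0" "\<forall>l<D. (\<Sum>i\<in>I. c i * z i l) = 0"
      using Suc.IH[of I z] Suc.prems by auto
    then show ?thesis using True by (intro exI[of _ c]) (auto simp: less_Suc_eq)
  next
    case False
    then obtain p where p: "p \<in> I" "z p D \<noteq> 0" by blast
    \<comment> \<open>Gaussian elimination: multiples of the pivot vector \<open>z p\<close> clear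
      coordinate \<open>D\<close>, leaving the first \<open>D\<close> coordinates to the induction
      hypothesis; \<open>b\<close> below is the coefficient that \<open>z p\<close> then
      receives.\<close>
    define y where "y i l = z i l - z i D / z p D * z p l" for i l
    have "D < card (I - {p})" using Suc.prems p by simp
    then obtain c where c: "\<exists>i\<in>I-{p}. c i \<noteq> 0" "\<forall>l<D. (\<Sum>i\<in>I-{p}. c i * y i l) = 0"
      using Suc.IH[of "I - {p}" y] Suc.prems by auto
    define b where "b = - (\<Sum>i\<in>I-{p}. c i * (z i D / z p D))"
    define c' where "c' = c(p := b)"
    have split: "(\<Sum>i\<in>I. c' i * z i l) = b * z p l + (\<Sum>i\<in>I-{p}. c i * z i l)" for l
      using p Suc.prems(1) by (simp add: sum.remove[OF _ p(1)] c'_def)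
    have yz: "(\<Sum>i\<in>I-{p}. c i * y i l) = b * z p l + (\<Sum>i\<in>I-{p}. c i * z i l)" for l
      unfolding b_def y_def
      by (simp add: sum_distrib_right sum_subtractf right_diff_distrib mult.assoc)
    have "(\<Sum>i\<in>I-{p}. c i * y i D) = 0" using p by (simp add: y_def)
    then have "(\<Sum>i\<in>I. c' i * z i l) = 0" if "l < Suc D" for l
      using that c(2) by (auto simp: split yz[symmetric] less_Suc_eq)
    moreover have "\<exists>i\<in>I. c' i \<noteq> 0" using c(1) by (auto simp: c'_def)
    ultimately show ?thesis by (intro exI[of _ c']) blast
  qed
qed

text \<open>Caratheodory's bound improves from \<open>D + 1\<close> to \<open>D\<close> points because all points used lie
  on the supporting hyperplane at the nearest point, which misses the origin.\<close>

lemma hull_dist2_small_subset: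
  assumes fin: "finite I" and ne: "I \<noteq> {}" and pos: "0 < hull_dist2 D z I"
  shows "\<exists>J\<subseteq>I. J \<noteq> {} \<and> card J \<le> D \<and> hull_dist2 D z J = hull_dist2 D z I"
proof -
  define P where "P J \<longleftrightarrow> J \<subseteq> I \<and> J \<noteq> {} \<and> hull_dist2 D z J = hull_dist2 D z I" for J
  have "P I" using ne by (simp add: P_def)
  then obtain J where J: "P J" and min: "\<And>J'. P J' \<Longrightarrow> card J \<le> card J'"
    using ex_has_least_nat[of P I card] by blast
  have finJ: "finite J" and JI: "J \<subseteq> I" "J \<noteq> {}"
    and hd: "hull_dist2 D z J = hull_dist2 D z I"
    using J fin finite_subset by (auto simp: P_def)
  \<comment> \<open>A minimiser with a vanishing weight would allow that index to be dropped from
    \<open>J\<close> without changing the distance, against minimality of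
    \<open>card J\<close>.\<close>
  have positive: "0 < v i" if v: "nearest_weights D z J v" and i: "i \<in> J" for v i
  proof (rule ccontr)
    assume "\<not> 0 < v i"
    then have 0: "v i = 0" using v i by (force simp: nearest_weights_def simplex_weights_def)
    have eq: "sum f J = f i + sum f (J - {i})" for f :: "_ \<Rightarrow> real"
      using finJ i by (simp add: sum.remove)
    have vs: "v \<in> simplex_weights (J - {i})"
      using v eq[of v] 0 by (auto simp: nearest_weights_def simplex_weights_def)
    have "comb z (J - {i}) v = comb z J v"
      by (rule ext) (simp add: comb_def eq 0)
    then have "hull_dist2 D z (J - {i}) \<le> hull_dist2 D z J"
      using hull_dist2_le[OF vs, of D z] v by (simp add: nearest_weights_def)
    moreover have ne': "J - {i} \<noteq> {}"
    proof
      assume "J - {i} = {}"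
      with vs show False unfolding simplex_weights_def by simp
    qed
    ultimately have "P (J - {i})"
      using hull_dist2_antimono[of "J - {i}" J D z] finJ hd JI by (auto simp: P_def)
    then show False using min[of "J - {i}"] i finJ card_Diff1_less[OF finJ i] by simp
  qed
  obtain w where w: "nearest_weights D z J w" using nearest_weights_exist finJ JI by blast
  define r where "r = comb z J w"
  have rr: "dot D r r = hull_dist2 D z J" using w by (simp add: nearest_weights_def r_def)
  have ws: "sum w J = 1" using w by (simp add: nearest_weights_def simplex_weights_def)
  \<comment> \<open>Complementary slackness: the terms are nonnegative with sum zero and the weights
    are positive, so every point of \<open>J\<close> lies on the supporting hyperplane.\<close>
  have "(\<Sum>i\<in>J. w i * (dot D r (z i) - dot D r r)) = dot D r r - sum w J * dot D r r"
    by (simp add: right_diff_distrib sum_subtractf sum_distrib_right dot_comb_right[symmetric] r_def[symmetric])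
  also have "\<dots> = 0" by (simp add: ws)
  finally have "\<forall>i\<in>J. w i * (dot D r (z i) - dot D r r) = 0"
    using finJ positive[OF w] nearest_weights_dot_ge[OF w _ finJ]
    by (subst (asm) sum_nonneg_eq_0_iff) (simp_all add: r_def[symmetric] rr less_imp_le)
  then have tight: "dot D r (z i) = dot D r r" if "i \<in> J" for i
    using that positive[OF w that] by auto
  have "card J \<le> D"
  proof (rule ccontr)
    assume "\<not> card J \<le> D"
    then obtain c where c: "\<exists>i\<in>J. c i \<noteq> 0" "\<forall>l<D. (\<Sum>i\<in>J. c i * z i l) = 0"
      using exists_linear_relation[OF finJ, of D z] by auto
    \<comment> \<open>Pairing the linear relation with \<open>r\<close> forces its coefficients to
      sum to zero, because \<open>dot D r r > 0\<close>. The relation is then affine, and moving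
      \<open>w\<close> along \<open>c\<close> keeps the total weight.\<close>
    have "(\<Sum>i\<in>J. c i) * dot D r r = dot D r (comb z J c)"
      by (simp add: dot_comb_right tight sum_distrib_right)
    also have "\<dots> = 0" using c(2) by (simp add: dot_def comb_def)
    finally have c0: "(\<Sum>i\<in>J. c i) = 0" using pos by (simp add: rr hd)
    define Neg where "Neg = {i\<in>J. c i < 0}"
    have "Neg \<noteq> {}"
    proof
      assume "Neg = {}"
      then have "\<forall>i\<in>J. 0 \<le> c i" by (force simp: Neg_def)
      then show False using c0 c(1) finJ by (simp add: sum_nonneg_eq_0_iff)
    qed
    moreover have "finite Neg" using finJ by (simp add: Neg_def)
    ultimately obtain k where k: "k \<in> Neg" "\<And>i. i \<in> Neg \<Longrightarrow> w k / - c k \<le> w i / - c i"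
      using ex_min_if_finite[of "(\<lambda>i. w i / - c i) ` Neg"] by (auto simp: not_less)
    \<comment> \<open>Ratio test: \<open>t\<close> is the largest step along \<open>c\<close> that
      keeps all weights nonnegative. The weight at \<open>k\<close> reaches zero there while the
      nearest point is unchanged, contradicting \<open>positive\<close>.\<close>
    define t where "t = w k / - c k"
    define v where "v i = w i + t * c i" for i
    have t: "0 < t" using k(1) positive[OF w, of k] by (auto simp: t_def Neg_def field_simps)
    have "0 \<le> v i" if i: "i \<in> J" for i
    proof (cases "c i < 0")
      case True
      then have "t \<le> w i / - c i" using k(2) i by (simp add: Neg_def t_def)
      then have "t * - c i \<le> w i" using True by (subst (asm) pos_le_divide_eq) auto
      then show ?thesis by (simp add: v_def)
    next
      case False
      then show ?thesis using t positive[OF w i] by (simp add: v_def)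
    qed
    then have "v \<in> simplex_weights J"
      using ws c0 by (simp add: simplex_weights_def v_def sum.distrib sum_distrib_left[symmetric])
    moreover have "comb z J v l = r l" if "l < D" for l
    proof -
      have "comb z J v l = r l + t * (\<Sum>i\<in>J. c i * z i l)"
        by (simp add: comb_def r_def v_def sum_distrib_left sum.distrib[symmetric] algebra_simps)
      then show ?thesis using c(2) that by simp
    qed
    then have "dot D (comb z J v) (comb z J v) = dot D r r" by (simp add: dot_def)
    ultimately have "nearest_weights D z J v" by (simp add: nearest_weights_def rr)
    moreover have "v k = 0" using k(1) by (simp add: v_def t_def Neg_def)
    ultimately show False using positive[of v k] k(1) by (simp add: Neg_def)
  qed
  then show ?thesis using JI hd by blast
qed

section \<open>Invariance under relabelling the points\<close>

lemma hull_dist2_reindex: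
  assumes "bij_betw f A B"
  shows "hull_dist2 D (\<lambda>i. z (f i)) A = hull_dist2 D z B"
proof -
  have sm: "(\<Sum>i\<in>A. g (f i)) = sum g B" for g :: "_ \<Rightarrow> real"
    using sum.reindex_bij_betw[OF assms] .
  have comb: "comb (\<lambda>i. z (f i)) A (\<lambda>i. w (f i)) = comb z B w" for w
    by (rule ext) (simp add: comb_def sm[of "\<lambda>i. w i * z i _"])
  have "(\<lambda>w. dot D (comb (\<lambda>i. z (f i)) A w) (comb (\<lambda>i. z (f i)) A w)) ` simplex_weights A
      = (\<lambda>w. dot D (comb z B w) (comb z B w)) ` simplex_weights B" (is "?F ` _ = ?G ` _")
  proof (intro equalityI image_subsetI)
    fix w assume w: "w \<in> simplex_weights A"
    define u where "u = (\<lambda>i. w (the_inv_into A f i))"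
    have uf: "u (f i) = w i" if "i \<in> A" for i
      using that assms by (simp add: u_def bij_betw_def the_inv_into_f_f)
    have "u \<in> simplex_weights B"
      using w assms by (auto simp: simplex_weights_def sm[symmetric] uf bij_betw_def)
    moreover have "comb (\<lambda>i. z (f i)) A w = comb z B u"
      unfolding comb[symmetric] by (rule ext) (simp add: comb_def uf)
    ultimately show "?F w \<in> ?G ` simplex_weights B" by auto
  next
    fix w assume w: "w \<in> simplex_weights B"
    then have "(\<lambda>i. w (f i)) \<in> simplex_weights A"
      using assms by (auto simp: simplex_weights_def sm bij_betw_def)
    then show "?G w \<in> ?F ` simplex_weights A" by (force simp: comb)
  qed
  then show ?thesis by (simp add: hull_dist2_def)
qed

lemma hull_dist2_cong:
  assumes "\<And>i. i \<in> I \<Longrightarrow> z i = z' i"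
  shows "hull_dist2 D z I = hull_dist2 D z' I"
proof -
  have "comb z I = comb z' I" by (intro ext) (simp add: comb_def assms)
  then show ?thesis by (simp add: hull_dist2_def)
qed

section \<open>Counting violator sets\<close>

text \<open>Expanding a product of sums over all subsets, with \<open>f\<close> zero on
  \<open>K\<close> and \<open>g\<close> zero on \<open>J\<close>, leaves only the sets between
  \<open>J\<close> and \<open>I - K\<close>. The value is the probability that a
  \<open>q\<close>-random subset contains \<open>J\<close> and misses \<open>K\<close>.\<close>

lemma sum_random_subset_between:
  fixes q :: real
  assumes "finite I" "K \<subseteq> I" "J \<subseteq> I" "J \<inter> K = {}"
  shows "(\<Sum>R | J \<subseteq> R \<and> R \<subseteq> I - K. q ^ card R * (1 - q) ^ card (I - R)) = q ^ card J * (1 - q) ^ card K"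
proof -
  define f where "f x = (if x \<in> K then 0 else q)" for x
  define g where "g x = (if x \<in> J then 0 else 1 - q)" for x
  have "(\<Sum>R\<in>Pow I. prod f R * prod g (I - R)) = (\<Prod>x\<in>I. f x + g x)"
    by (rule prod_add[OF assms(1), symmetric])
  also have "\<dots> = (\<Prod>x\<in>I. (if x \<in> J then q else 1) * (if x \<in> K then 1 - q else 1))"
    using assms(4) by (intro prod.cong) (auto simp: f_def g_def)
  also have "\<dots> = q ^ card J * (1 - q) ^ card K"
    using assms(1-3) by (simp add: prod.distrib prod.If_cases Int_absorb1)
  also have "(\<Sum>R\<in>Pow I. prod f R * prod g (I - R)) =
      (\<Sum>R | J \<subseteq> R \<and> R \<subseteq> I - K. prod f R * prod g (I - R))"
  proof (rule sum.mono_neutral_right)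
    show "\<forall>R\<in>Pow I - {R. J \<subseteq> R \<and> R \<subseteq> I - K}. prod f R * prod g (I - R) = 0"
    proof
      fix R assume R: "R \<in> Pow I - {R. J \<subseteq> R \<and> R \<subseteq> I - K}"
      then have fin: "finite R" "finite (I - R)" using assms(1) finite_subset by auto
      from R have "(\<exists>x\<in>R. x \<in> K) \<or> (\<exists>x\<in>I - R. x \<in> J)" using assms(3) by blast
      then show "prod f R * prod g (I - R) = 0"
        using fin by (auto simp: f_def g_def)
    qed
  qed (use assms(1) in auto)
  also have "\<dots> = (\<Sum>R | J \<subseteq> R \<and> R \<subseteq> I - K. q ^ card R * (1 - q) ^ card (I - R))"
  proof (rule sum.cong[OF refl])
    fix R assume "R \<in> {R. J \<subseteq> R \<and> R \<subseteq> I - K}"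
    then have "prod f R = (\<Prod>x\<in>R. q)" "prod g (I - R) = (\<Prod>x\<in>I - R. 1 - q)"
      unfolding f_def g_def by (intro prod.cong; auto)+
    then show "prod f R * prod g (I - R) = q ^ card R * (1 - q) ^ card (I - R)" by simp
  qed
  finally show ?thesis .
qed

text \<open>Clarkson--Shor sampling: let each index enter a random set \<open>R\<close> independently with
  probability \<open>q\<close>. If \<open>J \<subseteq> R \<subseteq> I - K\<close>, where at most \<open>D\<close> points \<open>J\<close> determine the nearest point
  for \<open>I - K\<close>, then \<open>K\<close> is the violator set of \<open>R\<close>; so these events are disjoint for distinct \<open>K\<close>.\<close>

lemma card_violator_sets_le:
  fixes q :: real
  assumes fin: "finite I" and q: "0 < q" "q < 1"
    and Ks: "\<And>K. K \<in> Ks \<Longrightarrow> K \<subseteq> I \<and> card K = k \<and> K \<noteq> I \<and> 0 < hull_dist2 D z (I - K) \<and>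
          (\<forall>i\<in>K. hull_dist2 D z (insert i (I - K)) < hull_dist2 D z (I - K))"
  shows "real (card Ks) * (q ^ D * (1 - q) ^ k) \<le> 1"
proof -
  define c where "c R = q ^ card R * (1 - q) ^ card (I - R)" for R
  have "\<exists>J. J \<subseteq> I - K \<and> J \<noteq> {} \<and> card J \<le> D \<and> hull_dist2 D z J = hull_dist2 D z (I - K)"
    if "K \<in> Ks" for K
    using hull_dist2_small_subset[of "I - K" D z] Ks[OF that] fin by blast
  then obtain J where J: "\<And>K. K \<in> Ks \<Longrightarrow> J K \<subseteq> I - K \<and> J K \<noteq> {} \<and> card (J K) \<le> D \<and>
      hull_dist2 D z (J K) = hull_dist2 D z (I - K)"
    by metis
  define A where "A K = {R. J K \<subseteq> R \<and> R \<subseteq> I - K}" for K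
  have viol: "K = {i\<in>I. hull_dist2 D z (insert i R) < hull_dist2 D z R}"
    if K: "K \<in> Ks" and R: "R \<in> A K" for K R
  proof -
    have R': "R \<subseteq> I - K" "R \<noteq> {}" "J K \<subseteq> R" using R J[OF K] by (auto simp: A_def)
    have finR: "finite R" using R' fin finite_subset by blast
    \<comment> \<open>Here \<open>J K \<subseteq> R \<subseteq> I - K\<close> with equal distances
      at both ends, so antitonicity pins the distance of \<open>R\<close> as well.\<close>
    have "hull_dist2 D z (I - K) = hull_dist2 D z R"
      using hull_dist2_antimono[of "J K" R D z] hull_dist2_antimono[of R "I - K" D z] R' J[OF K] finR fin
      by auto
    note eq = violated_iff_violated_superset[OF R'(1) _ R'(2) this, symmetric]
    have "i \<in> K \<longleftrightarrow> hull_dist2 D z (insert i (I - K)) < hull_dist2 D z (I - K)" if "i \<in> I" for i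
      using Ks[OF K] that by (cases "i \<in> K") (auto simp: insert_absorb)
    then show ?thesis using Ks[OF K] fin by (auto simp: eq)
  qed
  have finKs: "finite Ks" using Ks fin by (intro finite_subset[of Ks "Pow I"]) auto
  have "real (card Ks) * (q ^ D * (1 - q) ^ k) = (\<Sum>K\<in>Ks. q ^ D * (1 - q) ^ k)" by simp
  also have "\<dots> \<le> (\<Sum>K\<in>Ks. q ^ card (J K) * (1 - q) ^ card K)"
    using J Ks q by (intro sum_mono) (auto intro!: mult_mono power_decreasing)
  also have "\<dots> = (\<Sum>K\<in>Ks. sum c (A K))"
  proof (rule sum.cong[OF refl])
    fix K assume K: "K \<in> Ks"
    show "q ^ card (J K) * (1 - q) ^ card K = sum c (A K)"
      unfolding A_def c_def
      by (rule sum_random_subset_between[symmetric]) (use fin Ks[OF K] J[OF K] in auto)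
  qed
  also have "\<dots> = sum c (\<Union>K\<in>Ks. A K)"
  proof (rule sum.UNION_disjoint[symmetric, OF finKs])
    show "\<forall>K\<in>Ks. finite (A K)"
      using fin by (auto simp: A_def intro!: finite_subset[of _ "Pow I"])
    show "\<forall>K\<in>Ks. \<forall>K'\<in>Ks. K \<noteq> K' \<longrightarrow> A K \<inter> A K' = {}"
    proof (intro ballI impI)
      fix K K' assume "K \<in> Ks" "K' \<in> Ks" "K \<noteq> K'"
      then show "A K \<inter> A K' = {}" using viol[of K] viol[of K'] by fastforce
    qed
  qed
  also have "\<dots> \<le> sum c (Pow I)"
    using fin q by (intro sum_mono2) (auto simp: A_def c_def)
  also have "\<dots> = 1"
    using sum_random_subset_between[OF fin, of "{}" "{}" q] by (simp add: c_def Pow_def)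
  finally show ?thesis .
qed

section \<open>The probability of missing a neighbourhood of the mean\<close>

lemma nat_floor_scaled_tendsto:
  assumes "0 \<le> (x::real)"
  shows "(\<lambda>n. real (nat \<lfloor>real n * x\<rfloor>) / real n) \<longlonglongrightarrow> x"
proof (rule tendsto_sandwich)
  show "(\<lambda>n. x - inverse (real n)) \<longlonglongrightarrow> x"
    using tendsto_diff[OF tendsto_const lim_inverse_n, of x] by simp
  show "(\<lambda>n. x) \<longlonglongrightarrow> x" by simp
  show "\<forall>\<^sub>F n in sequentially. x - inverse (real n) \<le> real (nat \<lfloor>real n * x\<rfloor>) / real n"
    using eventually_gt_at_top[of 0]
  proof eventually_elim
    case (elim n)
    have "real n * x - 1 \<le> real (nat \<lfloor>real n * x\<rfloor>)" by linarith
    then have "(real n * x - 1) / real n \<le> real (nat \<lfloor>real n * x\<rfloor>) / real n"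
      by (rule divide_right_mono) simp
    then show ?case using elim by (simp add: diff_divide_distrib inverse_eq_divide)
  qed
  show "\<forall>\<^sub>F n in sequentially. real (nat \<lfloor>real n * x\<rfloor>) / real n \<le> x"
    using eventually_gt_at_top[of 0]
  proof eventually_elim
    case (elim n)
    have "0 \<le> real n * x" using assms by simp
    then have "real (nat \<lfloor>real n * x\<rfloor>) \<le> real n * x" by linarith
    then show ?case using elim by (simp add: field_simps)
  qed
qed

text \<open>Integer weights suffice, which makes the distance measurable as a countable infimum.\<close>

lemma hull_dist2_less_iff:
  assumes fin: "finite I" and ne: "I \<noteq> {}"
  shows "hull_dist2 D z I < c \<longleftrightarrow>
    (\<exists>a\<in>PiE I (\<lambda>_. UNIV :: nat set). 0 < sum a I \<and>
      dot D (comb z I (\<lambda>i. real (a i))) (comb z I (\<lambda>i. real (a i))) < c * (\<Sum>i\<in>I. real (a i))\<^sup>2)"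
    (is "_ \<longleftrightarrow> ?R")
proof
  have scale: "dot D (comb z I (\<lambda>i. v i / s)) (comb z I (\<lambda>i. v i / s))
      = dot D (comb z I v) (comb z I v) / s\<^sup>2" for v :: "_ \<Rightarrow> real" and s
    by (simp add: dot_def comb_def sum_divide_distrib[symmetric] power2_eq_square)
  show "hull_dist2 D z I < c" if ?R
  proof -
    from that obtain a where a: "0 < sum a I"
      "dot D (comb z I (\<lambda>i. real (a i))) (comb z I (\<lambda>i. real (a i))) < c * (\<Sum>i\<in>I. real (a i))\<^sup>2"
      by blast
    define s where "s = (\<Sum>i\<in>I. real (a i))"
    have s: "0 < s" using a(1) by (simp add: s_def flip: of_nat_sum)
    have "(\<lambda>i. real (a i) / s) \<in> simplex_weights I"
      using s by (auto simp: simplex_weights_def sum_divide_distrib[symmetric] s_def[symmetric])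
    from hull_dist2_le[OF this, of D z]
    have "hull_dist2 D z I \<le> dot D (comb z I (\<lambda>i. real (a i))) (comb z I (\<lambda>i. real (a i))) / s\<^sup>2"
      by (simp add: scale)
    also have "\<dots> < c" using a(2) s by (simp add: s_def[symmetric] pos_divide_less_eq)
    finally show ?thesis .
  qed
  show ?R if lt: "hull_dist2 D z I < c"
  proof -
    obtain w where w: "nearest_weights D z I w" using nearest_weights_exist[OF fin ne] by blast
    \<comment> \<open>Rounding \<open>n\<close> times the optimal weights down gives integer
      weights. After division by \<open>n\<close> they converge to \<open>w\<close>, and the target
      inequality, being strict, survives for large \<open>n\<close>; the total weight may differ
      from 1, hence the factor \<open>(sum (W n) I)\<^sup>2\<close>.\<close>
    define W where "W n i = real (nat \<lfloor>real n * w i\<rfloor>) / real n" for n i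
    have W: "(\<lambda>n. W n i) \<longlonglongrightarrow> w i" if "i \<in> I" for i
      unfolding W_def using that w
      by (intro nat_floor_scaled_tendsto) (auto simp: nearest_weights_def simplex_weights_def)
    have sumW: "(\<lambda>n. sum (W n) I) \<longlonglongrightarrow> 1"
      using tendsto_sum[of I "\<lambda>i n. W n i" w sequentially] W w
      by (simp add: nearest_weights_def simplex_weights_def)
    have "(\<lambda>n. dot D (comb z I (W n)) (comb z I (W n)) - c * (sum (W n) I)\<^sup>2)
        \<longlonglongrightarrow> dot D (comb z I w) (comb z I w) - c * 1\<^sup>2"
      unfolding dot_def comb_def by (intro tendsto_intros W sumW)
    moreover have "dot D (comb z I w) (comb z I w) - c * 1\<^sup>2 < 0"
      using w lt by (simp add: nearest_weights_def)
    ultimately have "\<forall>\<^sub>F n in sequentially. dot D (comb z I (W n)) (comb z I (W n)) - c * (sum (W n) I)\<^sup>2 < 0"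
      by (rule order_tendstoD(2))
    moreover have "\<forall>\<^sub>F n in sequentially. 0 < sum (W n) I"
      using order_tendstoD(1)[OF sumW, of 0] by simp
    ultimately have "\<forall>\<^sub>F n in sequentially. n > 0 \<and> 0 < sum (W n) I \<and>
        dot D (comb z I (W n)) (comb z I (W n)) < c * (sum (W n) I)\<^sup>2"
      using eventually_gt_at_top[of 0] by eventually_elim simp
    then obtain n where n: "n > 0" "0 < sum (W n) I"
      "dot D (comb z I (W n)) (comb z I (W n)) < c * (sum (W n) I)\<^sup>2"
      using eventually_happens'[OF sequentially_bot] by blast
    define a where "a = (\<lambda>i\<in>I. nat \<lfloor>real n * w i\<rfloor>)"
    have aW: "comb z I (\<lambda>i. real (a i) / real n) = comb z I (W n)"
      by (rule ext) (simp add: comb_def a_def W_def)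
    have sa: "(\<Sum>i\<in>I. real (a i)) / real n = sum (W n) I"
      by (simp add: sum_divide_distrib a_def W_def)
    have "dot D (comb z I (\<lambda>i. real (a i))) (comb z I (\<lambda>i. real (a i))) < c * (\<Sum>i\<in>I. real (a i))\<^sup>2"
      using n(3)[folded aW sa] n(1) by (simp add: scale power_divide divide_less_cancel)
    moreover have "0 < (\<Sum>i\<in>I. real (a i))"
      using n(2)[folded sa] n(1) by (simp add: zero_less_divide_iff)
    then have "0 < sum a I" by (simp flip: of_nat_sum)
    moreover have "a \<in> PiE I (\<lambda>_. UNIV)" by (simp add: a_def)
    ultimately show ?R by blast
  qed
qed

lemma borel_measurable_hull_dist2:
  assumes fin: "finite I" and ne: "I \<noteq> {}" and sub: "I \<subseteq> L"
    and z: "\<And>l. l < D \<Longrightarrow> (\<lambda>x. z x l) \<in> borel_measurable M"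
  shows "(\<lambda>xs. hull_dist2 D (\<lambda>i. z (xs i)) I) \<in> borel_measurable (PiM L (\<lambda>_. M))"
  unfolding borel_measurable_iff_less
proof
  fix c
  let ?P = "PiM L (\<lambda>_. M)"
  let ?A = "\<lambda>a::_\<Rightarrow>nat. {xs\<in>space ?P. 0 < sum a I \<and>
      dot D (comb (\<lambda>i. z (xs i)) I (\<lambda>i. real (a i))) (comb (\<lambda>i. z (xs i)) I (\<lambda>i. real (a i)))
        < c * (\<Sum>i\<in>I. real (a i))\<^sup>2}"
  have [measurable]: "(\<lambda>xs. z (xs i) l) \<in> borel_measurable ?P" if "i \<in> I" "l < D" for i l
    by (rule measurable_compose[where N = M and f = "\<lambda>xs. xs i"])
      (use that sub z in \<open>auto intro: measurable_component_singleton\<close>)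
  have "(\<lambda>xs. dot D (comb (\<lambda>i. z (xs i)) I (\<lambda>i. real (a i))) (comb (\<lambda>i. z (xs i)) I (\<lambda>i. real (a i))))
      \<in> borel_measurable ?P" for a :: "_ \<Rightarrow> nat"
    unfolding dot_def comb_def
    by (intro borel_measurable_sum borel_measurable_times borel_measurable_const) auto
  then have A: "?A a \<in> sets ?P" for a by measurable
  \<comment> \<open>Extensional functions on the finite set \<open>I\<close> are countable in
    number, so the union below is a countable one.\<close>
  have cnt: "countable (PiE I (\<lambda>_. UNIV :: nat set))" using fin by (intro countable_PiE) auto
  have eq: "{xs \<in> space ?P. hull_dist2 D (\<lambda>i. z (xs i)) I < c} = (\<Union>a\<in>PiE I (\<lambda>_. UNIV). ?A a)"
    by (subst hull_dist2_less_iff[OF fin ne]) blast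
  show "{xs \<in> space ?P. hull_dist2 D (\<lambda>i. z (xs i)) I < c} \<in> sets ?P"
    unfolding eq by (rule sets.countable_UN''[OF cnt A])
qed

section \<open>Violation probabilities for independent points\<close>

context prob_space
begin

text \<open>Let \<open>\<rho>\<close> be the norm of \<open>r\<close>. The function
  \<open>dot D r (z x)\<close> has mean zero, is at least \<open>\<rho>\<^sup>2\<close> outside the
  half-space and at least \<open>- \<rho> * R\<close> inside, so the half-space has probability at
  least \<open>\<rho> / (R + \<rho>)\<close>, which increases with \<open>\<rho>\<close>.\<close>

lemma violation_prob_ge:
  assumes z: "\<And>l. l < D \<Longrightarrow> (\<lambda>x. z x l) \<in> borel_measurable M"
    and bnd: "\<And>x. x \<in> space M \<Longrightarrow> dot D (z x) (z x) \<le> R\<^sup>2" and R: "0 \<le> R"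
    and mean: "\<And>l. l < D \<Longrightarrow> (\<integral>x. z x l \<partial>M) = 0"
    and \<eta>: "0 < \<eta>" "\<eta>\<^sup>2 < dot D r r"
  shows "\<eta> / (R + \<eta>) \<le> prob {x\<in>space M. dot D r (z x) < dot D r r}"
proof -
  define \<rho> where "\<rho> = sqrt (dot D r r)"
  have \<rho>2: "\<rho>\<^sup>2 = dot D r r" by (simp add: \<rho>_def dot_self_nonneg)
  have "sqrt (\<eta>\<^sup>2) < \<rho>" unfolding \<rho>_def using \<eta>(2) by (rule real_sqrt_less_mono)
  then have \<rho>: "\<eta> < \<rho>" using \<eta>(1) by simp
  define B where "B = {x\<in>space M. dot D r (z x) < dot D r r}"
  have int: "integrable M (\<lambda>x. z x l)" if l: "l < D" for l
  proof (rule integrable_const_bound[where B = R])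
    show "AE x in M. norm (z x l) \<le> R"
    proof (rule AE_I2)
      fix x assume x: "x \<in> space M"
      have "(z x l)\<^sup>2 \<le> dot D (z x) (z x)"
        unfolding dot_def power2_eq_square using l by (intro member_le_sum) auto
      also have "\<dots> \<le> R\<^sup>2" by (rule bnd[OF x])
      finally show "norm (z x l) \<le> R" using R by (simp add: abs_le_square_iff[symmetric])
    qed
  qed (rule z[OF l])
  have B: "B \<in> events"
    unfolding B_def dot_def using z by measurable
  have intf: "integrable M (\<lambda>x. dot D r (z x))" unfolding dot_def using int by auto
  have "(\<integral>x. dot D r (z x) \<partial>M) = 0" unfolding dot_def using int mean by simp
  moreover have "(\<integral>x. \<rho>\<^sup>2 - (\<rho>\<^sup>2 + \<rho> * R) * indicator B x \<partial>M) \<le> (\<integral>x. dot D r (z x) \<partial>M)"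
  proof (rule integral_mono)
    fix x assume x: "x \<in> space M"
    have "\<bar>dot D r (z x)\<bar> \<le> \<rho> * sqrt (dot D (z x) (z x))" unfolding \<rho>_def by (rule abs_dot_le)
    also have "\<dots> \<le> \<rho> * R"
      using bnd[OF x] R \<rho> \<eta> by (intro mult_left_mono real_le_lsqrt) auto
    finally show "\<rho>\<^sup>2 - (\<rho>\<^sup>2 + \<rho> * R) * indicator B x \<le> dot D r (z x)"
      using x by (auto simp: B_def \<rho>2 indicator_def)
  qed (use B intf in \<open>auto simp: emeasure_eq_measure\<close>)
  moreover have "(\<integral>x. \<rho>\<^sup>2 - (\<rho>\<^sup>2 + \<rho> * R) * indicator B x \<partial>M) = \<rho>\<^sup>2 - (\<rho>\<^sup>2 + \<rho> * R) * prob B"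
    using B by (simp add: emeasure_eq_measure prob_space)
  ultimately have "\<rho> * \<rho> \<le> \<rho> * ((R + \<rho>) * prob B)" by (simp add: power2_eq_square algebra_simps)
  then have "\<rho> \<le> (R + \<rho>) * prob B" using \<rho> \<eta> by simp
  then have "\<rho> / (R + \<rho>) \<le> prob B" using \<rho> \<eta> R by (simp add: divide_le_eq mult.commute)
  moreover have "\<eta> / (R + \<eta>) \<le> \<rho> / (R + \<rho>)"
    using \<rho> \<eta> R by (simp add: divide_simps algebra_simps mult_left_mono)
  ultimately show ?thesis by (simp add: B_def)
qed

text \<open>Conditioning on the points in \<open>S\<close> fixes the nearest point and its
  half-space. The points in \<open>K\<close> are independent of them and, when the distance exceeds
  \<open>\<eta>\<close>, each lands in the half-space with probability at least
  \<open>\<eta> / (R + \<eta>)\<close>; Fubini yields the power.\<close>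

lemma violators_prob_ge:
  assumes fin: "finite S" "finite K" and disj: "S \<inter> K = {}" and ne: "S \<noteq> {}"
    and z: "\<And>l. l < D \<Longrightarrow> (\<lambda>x. z x l) \<in> borel_measurable M"
    and bnd: "\<And>x. x \<in> space M \<Longrightarrow> dot D (z x) (z x) \<le> R\<^sup>2" and R: "0 \<le> R"
    and mean: "\<And>l. l < D \<Longrightarrow> (\<integral>x. z x l \<partial>M) = 0"
    and \<eta>: "0 < \<eta>"
  defines "h \<equiv> \<lambda>xs I. hull_dist2 D (\<lambda>i. z (xs i)) I"
  shows "(\<eta> / (R + \<eta>)) ^ card K * measure (PiM S (\<lambda>_. M)) {xs\<in>space (PiM S (\<lambda>_. M)). \<eta>\<^sup>2 < h xs S}
    \<le> measure (PiM (S \<union> K) (\<lambda>_. M))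
        {xs\<in>space (PiM (S \<union> K) (\<lambda>_. M)). \<eta>\<^sup>2 < h xs S \<and> (\<forall>i\<in>K. h xs (insert i S) < h xs S)}"
    (is "?\<alpha> ^ _ * measure ?PS ?F \<le> measure ?P ?V")
proof -
  interpret PS: product_sigma_finite "\<lambda>_. M" ..
  interpret S: prob_space ?PS by (rule prob_space_PiM) (rule prob_space_axioms)
  interpret SK: prob_space ?P by (rule prob_space_PiM) (rule prob_space_axioms)
  have [measurable]: "(\<lambda>xs. h xs S) \<in> borel_measurable ?PS" "(\<lambda>xs. h xs S) \<in> borel_measurable ?P"
    unfolding h_def by (intro borel_measurable_hull_dist2 fin ne z; auto)+
  have [measurable]: "(\<lambda>xs. h xs (insert i S)) \<in> borel_measurable ?P" if "i \<in> K" for i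
    unfolding h_def by (intro borel_measurable_hull_dist2) (use fin ne z that in auto)
  have F: "?F \<in> sets ?PS" by measurable
  have V: "?V \<in> sets ?P" using fin by measurable
  have \<alpha>: "0 \<le> ?\<alpha>" using R \<eta> by simp
  have "ennreal (?\<alpha> ^ card K * measure ?PS ?F) = ennreal (?\<alpha> ^ card K) * emeasure ?PS ?F"
    using \<alpha> by (simp add: ennreal_mult S.emeasure_eq_measure)
  also have "\<dots> = (\<integral>\<^sup>+x. ennreal (?\<alpha> ^ card K) * indicator ?F x \<partial>?PS)"
    using F by (simp add: nn_integral_cmult_indicator)
  also have "\<dots> \<le> (\<integral>\<^sup>+x. emeasure (PiM K (\<lambda>_. M))
      ((\<lambda>y. merge S K (x, y)) -` ?V \<inter> space (PiM K (\<lambda>_. M))) \<partial>?PS)"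
  proof (rule nn_integral_mono)
    fix x assume x: "x \<in> space ?PS"
    let ?E = "(\<lambda>y. merge S K (x, y)) -` ?V \<inter> space (PiM K (\<lambda>_. M))"
    show "ennreal (?\<alpha> ^ card K) * indicator ?F x \<le> emeasure (PiM K (\<lambda>_. M)) ?E"
    proof (cases "x \<in> ?F")
      case True
      obtain w where w: "nearest_weights D (\<lambda>i. z (x i)) S w"
        using nearest_weights_exist[OF fin(1) ne] by blast
      define r where "r = comb (\<lambda>i. z (x i)) S w"
      have rr: "dot D r r = h x S" using w by (simp add: nearest_weights_def r_def h_def)
      define B where "B = {y\<in>space M. dot D r (z y) < dot D r r}"
      have B: "B \<in> events" unfolding B_def dot_def using z by measurable
      have probB: "?\<alpha> \<le> prob B"
        unfolding B_def using True rr by (intro violation_prob_ge z bnd R mean \<eta>) auto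
      have "PiE K (\<lambda>_. B) \<subseteq> ?E"
      proof
        fix y assume y: "y \<in> PiE K (\<lambda>_. B)"
        then have ysp: "y \<in> space (PiM K (\<lambda>_. M))" by (auto simp: space_PiM B_def)
        let ?m = "merge S K (x, y)"
        have mS: "?m i = x i" if "i \<in> S" for i using that by (simp add: merge_def)
        have mK: "?m i = y i" if "i \<in> K" for i using that disj by (auto simp: merge_def)
        have msp: "?m \<in> space ?P" using x ysp mS mK by (auto simp: space_PiM)
        have hS: "h ?m S = h x S" unfolding h_def by (rule hull_dist2_cong) (simp add: mS)
        have cm: "comb (\<lambda>i. z (?m i)) S w = r"
          unfolding r_def by (rule ext) (simp add: comb_def mS)
        have wm: "nearest_weights D (\<lambda>i. z (?m i)) S w"
          using w hS rr by (simp add: nearest_weights_def cm h_def)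
        have "h ?m (insert i S) < h ?m S" if i: "i \<in> K" for i
        proof -
          have "y i \<in> B" using y i by auto
          then have "dot D r (z (?m i)) < hull_dist2 D (\<lambda>i. z (?m i)) S"
            using hS rr by (simp add: B_def mK[OF i] h_def)
          then show ?thesis
            unfolding h_def nearest_weights_violated[OF wm fin(1) ne] cm .
        qed
        then show "y \<in> ?E" using True ysp msp hS by auto
      qed
      moreover have "?E \<in> sets (PiM K (\<lambda>_. M))"
      proof (rule measurable_sets[OF _ V])
        show "(\<lambda>y. merge S K (x, y)) \<in> measurable (PiM K (\<lambda>_. M)) ?P"
          using measurable_compose[OF measurable_Pair1'[OF x] measurable_merge, of K] by simp
      qed
      ultimately have mono: "emeasure (PiM K (\<lambda>_. M)) (PiE K (\<lambda>_. B)) \<le> emeasure (PiM K (\<lambda>_. M)) ?E"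
        by (rule emeasure_mono)
      have "ennreal (?\<alpha> ^ card K) \<le> ennreal (prob B ^ card K)"
        using probB \<alpha> by (intro ennreal_leI power_mono)
      also have "\<dots> = emeasure (PiM K (\<lambda>_. M)) (PiE K (\<lambda>_. B))"
        using B fin(2) by (simp add: PS.emeasure_PiM emeasure_eq_measure ennreal_power)
      also note mono
      finally show ?thesis using True by simp
    qed simp
  qed
  also have "\<dots> = emeasure ?P ?V"
    by (rule PS.emeasure_fold_integral[symmetric, OF disj fin V])
  also have "\<dots> = ennreal (measure ?P ?V)" by (simp add: SK.emeasure_eq_measure)
  finally show ?thesis by simp
qed

text \<open>Points are identically distributed, so only their number matters: any \<open>N\<close>
  of the \<open>N + k\<close> indices can serve as the sample.\<close>

lemma measure_PiM_hull_dist2_reindex: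
  assumes fin: "finite S" and ne: "S \<noteq> {}" and f: "bij_betw f A S"
    and z: "\<And>l. l < D \<Longrightarrow> (\<lambda>x. z x l) \<in> borel_measurable M"
  shows "measure (PiM S (\<lambda>_. M)) {xs\<in>space (PiM S (\<lambda>_. M)). c < hull_dist2 D (\<lambda>i. z (xs i)) S}
       = measure (PiM A (\<lambda>_. M)) {xs\<in>space (PiM A (\<lambda>_. M)). c < hull_dist2 D (\<lambda>i. z (xs i)) A}"
    (is "measure ?S ?FS = measure ?A ?FA")
proof -
  let ?t = "\<lambda>\<omega>. \<lambda>n\<in>A. \<omega> (f n)"
  have finA: "finite A" and neA: "A \<noteq> {}" using f fin ne bij_betw_finite by (auto simp: bij_betw_def)
  have [measurable]: "(\<lambda>xs. hull_dist2 D (\<lambda>i. z (xs i)) A) \<in> borel_measurable ?A"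
    by (intro borel_measurable_hull_dist2 finA neA z) auto
  have FA: "?FA \<in> sets ?A" by measurable
  have fm: "f n \<in> S" if "n \<in> A" for n using f that by (auto simp: bij_betw_def)
  have t: "?t \<in> measurable ?S ?A"
    by (intro measurable_restrict measurable_component_singleton) (auto simp: fm)
  have "distr ?S ?A ?t = ?A"
    using distr_PiM_reindex[of S "\<lambda>_. M" f A] f prob_space_axioms by (auto simp: bij_betw_def)
  then have "measure ?A ?FA = measure (distr ?S ?A ?t) ?FA" by simp
  also have "\<dots> = measure ?S (?t -` ?FA \<inter> space ?S)" by (rule measure_distr[OF t FA])
  also have "?t -` ?FA \<inter> space ?S = ?FS"
  proof -
    have "hull_dist2 D (\<lambda>i. z (?t xs i)) A = hull_dist2 D (\<lambda>i. z (xs i)) S" for xs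
      using hull_dist2_reindex[OF f, of D "\<lambda>i. z (xs i)"]
        hull_dist2_cong[of A "\<lambda>i. z (?t xs i)" "\<lambda>i. z (xs (f i))" D] by simp
    then show ?thesis using measurable_space[OF t] by auto
  qed
  finally show ?thesis by simp
qed

text \<open>Adding \<open>k\<close> ghost points: if the first \<open>N\<close> points fail, then all ghost points violate their
  nearest point with probability at least \<open>\<alpha>\<^sup>k\<close>; by exchangeability every \<open>k\<close>-subset of the
  \<open>N + k\<close> points is equally likely to play the ghosts, but few subsets can be violator sets.\<close>

lemma hull_miss_prob_le:
  fixes q :: real
  assumes z: "\<And>l. l < D \<Longrightarrow> (\<lambda>x. z x l) \<in> borel_measurable M"
    and bnd: "\<And>x. x \<in> space M \<Longrightarrow> dot D (z x) (z x) \<le> R\<^sup>2" and R: "0 \<le> R"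
    and mean: "\<And>l. l < D \<Longrightarrow> (\<integral>x. z x l \<partial>M) = 0"
    and \<eta>: "0 < \<eta>" and q: "0 < q" "q < 1" and N: "0 < N"
  shows "measure (PiM {..<N} (\<lambda>_. M))
      {xs\<in>space (PiM {..<N} (\<lambda>_. M)). \<eta>\<^sup>2 < hull_dist2 D (\<lambda>i. z (xs i)) {..<N}}
    * (\<eta> / (R + \<eta>)) ^ k * real ((N + k) choose k) * (q ^ D * (1 - q) ^ k) \<le> 1"
    (is "?p * ?\<alpha> ^ k * _ * ?Q \<le> 1")
proof -
  define I where "I = {..<N + k}"
  let ?P = "PiM I (\<lambda>_. M)"
  define h where "h xs J = hull_dist2 D (\<lambda>i. z (xs i)) J" for xs and J :: "nat set"
  define \<K> where "\<K> = {K. K \<subseteq> I \<and> card K = k}"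
  define V where "V K = {xs\<in>space ?P. \<eta>\<^sup>2 < h xs (I - K) \<and> (\<forall>i\<in>K. h xs (insert i (I - K)) < h xs (I - K))}" for K
  interpret P: prob_space ?P by (rule prob_space_PiM) (rule prob_space_axioms)
  have finI: "finite I" by (simp add: I_def)
  have fin\<K>: "finite \<K>" unfolding \<K>_def using finI by (auto intro: finite_subset[of _ "Pow I"])
  have card\<K>: "card \<K> = (N + k) choose k"
    unfolding \<K>_def using n_subsets[OF finI, of k] by (simp add: I_def)
  have sub: "finite K" "finite (I - K)" "I - K \<noteq> {}" "card (I - K) = N" "I - K \<union> K = I" if "K \<in> \<K>" for K
  proof -
    show "finite K" "finite (I - K)" "I - K \<union> K = I"
      using that finI finite_subset by (auto simp: \<K>_def)
    show c: "card (I - K) = N"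
      using that card_Diff_subset[of K I] finite_subset[OF _ finI, of K] by (simp add: \<K>_def I_def)
    show "I - K \<noteq> {}" using c N by (metis card.empty less_irrefl)
  qed
  have ge: "?p * ?\<alpha> ^ k \<le> measure ?P (V K)" if K: "K \<in> \<K>" for K
  proof -
    obtain f where f: "bij_betw f {..<N} (I - K)"
      using bij_betw_iff_card[of "{..<N}" "I - K"] sub[OF K] by auto
    have "?p = measure (PiM (I - K) (\<lambda>_. M))
        {xs\<in>space (PiM (I - K) (\<lambda>_. M)). \<eta>\<^sup>2 < hull_dist2 D (\<lambda>i. z (xs i)) (I - K)}"
      by (rule measure_PiM_hull_dist2_reindex[symmetric, OF sub(2,3)[OF K] f z])
    moreover have "card K = k" using K by (simp add: \<K>_def)
    moreover have "(I - K) \<inter> K = {}" by blast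
    note violators_prob_ge[where z = z and D = D and R = R, OF sub(2,1)[OF K] this sub(3)[OF K] z bnd R mean \<eta>]
    ultimately show ?thesis
      unfolding sub(5)[OF K] V_def h_def by (simp add: mult.commute)
  qed
  have V: "V K \<in> sets ?P" if K: "K \<in> \<K>" for K
  proof -
    have [measurable]: "(\<lambda>xs. h xs (I - K)) \<in> borel_measurable ?P"
      unfolding h_def by (intro borel_measurable_hull_dist2 z) (use sub[OF K] in auto)
    have [measurable]: "(\<lambda>xs. h xs (insert i (I - K))) \<in> borel_measurable ?P" if "i \<in> K" for i
      unfolding h_def by (intro borel_measurable_hull_dist2 z) (use sub[OF K] that K in \<open>auto simp: \<K>_def\<close>)
    show ?thesis unfolding V_def using sub(1)[OF K] by measurable
  qed
  have Q: "0 < ?Q" using q by simp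
  have "?p * ?\<alpha> ^ k * real ((N + k) choose k) = (\<Sum>K\<in>\<K>. ?p * ?\<alpha> ^ k)"
    by (simp add: card\<K> mult.commute)
  \<comment> \<open>Double counting: the sum of the probabilities of the \<open>V K\<close> is the
    expected number of violator sets, which \<open>card_violator_sets_le\<close> bounds
    pointwise.\<close>
  also have "\<dots> \<le> (\<Sum>K\<in>\<K>. measure ?P (V K))" by (intro sum_mono ge)
  also have "\<dots> = (\<integral>xs. (\<Sum>K\<in>\<K>. indicator (V K) xs) \<partial>?P)"
    using V by (subst Bochner_Integration.integral_sum) (auto simp: P.emeasure_eq_measure)
  also have "\<dots> \<le> (\<integral>xs. 1 / ?Q \<partial>?P)"
  proof (rule integral_mono)
    fix xs assume "xs \<in> space ?P"
    define Ks where "Ks = {K\<in>\<K>. xs \<in> V K}"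
    have "(\<Sum>K\<in>\<K>. indicator (V K) xs) = real (card Ks)"
      unfolding Ks_def using fin\<K> by (simp add: indicator_def sum.If_cases Int_def)
    moreover have "real (card Ks) * ?Q \<le> 1"
    proof (rule card_violator_sets_le[OF finI q, where z = "\<lambda>i. z (xs i)"])
      fix K assume "K \<in> Ks"
      then have K: "K \<in> \<K>" "xs \<in> V K" by (auto simp: Ks_def)
      have "\<eta>\<^sup>2 < hull_dist2 D (\<lambda>i. z (xs i)) (I - K)" using K(2) by (simp add: V_def h_def)
      moreover have "0 < \<eta>\<^sup>2" using \<eta> by simp
      ultimately have "0 < hull_dist2 D (\<lambda>i. z (xs i)) (I - K)" by linarith
      then show "K \<subseteq> I \<and> card K = k \<and> K \<noteq> I \<and> 0 < hull_dist2 D (\<lambda>i. z (xs i)) (I - K) \<and>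
          (\<forall>i\<in>K. hull_dist2 D (\<lambda>i. z (xs i)) (insert i (I - K)) < hull_dist2 D (\<lambda>i. z (xs i)) (I - K))"
        using K sub(3)[OF K(1)] by (auto simp: \<K>_def V_def h_def)
    qed
    then have "real (card Ks) \<le> 1 / ?Q" using Q by (simp add: pos_le_divide_eq)
    ultimately show "(\<Sum>K\<in>\<K>. indicator (V K) xs) \<le> 1 / ?Q" by simp
  qed (use V in \<open>auto simp: P.emeasure_eq_measure\<close>)
  also have "\<dots> = 1 / ?Q" by (simp add: P.prob_space)
  finally show ?thesis using Q by (simp add: pos_le_divide_eq)
qed

end

section \<open>Mercer coordinates and the worst-case error\<close>

lemma sums_Cauchy_Schwarz:
  fixes a b :: "nat \<Rightarrow> real"
  assumes a: "(\<lambda>j. (a j)\<^sup>2) sums A" and b: "(\<lambda>j. (b j)\<^sup>2) sums B" and ab: "(\<lambda>j. a j * b j) sums C"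
  shows "\<bar>C\<bar> \<le> sqrt A * sqrt B"
proof (rule LIMSEQ_le_const2)
  show "(\<lambda>n. \<bar>\<Sum>j<n. a j * b j\<bar>) \<longlonglongrightarrow> \<bar>C\<bar>"
    using ab unfolding sums_def by (rule tendsto_rabs)
  have "\<bar>\<Sum>j<n. a j * b j\<bar> \<le> sqrt A * sqrt B" for n
  proof -
    have "\<bar>\<Sum>j<n. a j * b j\<bar> = sqrt ((\<Sum>j<n. a j * b j)\<^sup>2)" by simp
    also have "\<dots> \<le> sqrt ((\<Sum>j<n. (a j)\<^sup>2) * (\<Sum>j<n. (b j)\<^sup>2))"
      by (intro real_sqrt_le_mono Cauchy_Schwarz_ineq_sum)
    also have "\<dots> = sqrt (\<Sum>j<n. (a j)\<^sup>2) * sqrt (\<Sum>j<n. (b j)\<^sup>2)" by (rule real_sqrt_mult)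
    also have "\<dots> \<le> sqrt A * sqrt B"
      using a b by (intro mult_mono real_sqrt_le_mono real_sqrt_ge_zero sum_nonneg)
        (auto intro!: sum_le_suminf simp: sums_iff suminf_nonneg)
    finally show ?thesis .
  qed
  then show "\<exists>N. \<forall>n\<ge>N. \<bar>\<Sum>j<n. a j * b j\<bar> \<le> sqrt A * sqrt B" by blast
qed

locale mercer_kernel = prob_space M for M :: "'a measure" +
  fixes k :: "'a \<Rightarrow> 'a \<Rightarrow> real" and Phi :: "'a \<Rightarrow> 'h::real_inner"
    and \<sigma> :: "nat \<Rightarrow> real" and e :: "nat \<Rightarrow> 'a \<Rightarrow> real" and d :: nat
  assumes feature: "x \<in> space M \<Longrightarrow> y \<in> space M \<Longrightarrow> k x y = Phi x \<bullet> Phi y"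
    and dense: "closure (span (Phi ` space M)) = UNIV"
    and meas_H: "(\<lambda>x. h \<bullet> Phi x) \<in> borel_measurable M"
    and bounded: "bdd_above ((\<lambda>x. sqrt (k x x)) ` space M)"
    and e_meas [measurable]: "e j \<in> borel_measurable M"
    and e_L2: "integrable M (\<lambda>x. (e j x)\<^sup>2)"
    and e_norm: "(\<integral>x. (e j x)\<^sup>2 \<partial>M) = 1"
    and \<sigma>_nonneg: "0 \<le> \<sigma> j"
    and mercer: "x \<in> space M \<Longrightarrow> y \<in> space M \<Longrightarrow> (\<lambda>j. \<sigma> j * e j x * e j y) sums k x y"
begin

definition \<kappa> :: real where "\<kappa> = (SUP x\<in>space M. sqrt (k x x))"

text \<open>The norm of the Mercer coordinates of \<open>x\<close> after the first \<open>d\<close>.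
  Indices start at 0, so \<open>j + d\<close> ranges over what is \<open>j > d\<close> in one-based
  numbering.\<close>

definition tail :: "'a \<Rightarrow> real" where
  "tail x = sqrt (\<Sum>j. \<sigma> (j + d) * (e (j + d) x)\<^sup>2)"

text \<open>The tail norm enters as an extra coordinate so that a convex combination close to the mean
  also has a small average tail norm.\<close>

definition coord :: "'a \<Rightarrow> nat \<Rightarrow> real" where
  "coord x l = (if l < d then sqrt (\<sigma> l) * e l x else tail x)"

definition cmean :: "nat \<Rightarrow> real" where "cmean l = (\<integral>x. coord x l \<partial>M)"

definition ccoord :: "'a \<Rightarrow> nat \<Rightarrow> real" where "ccoord x l = coord x l - cmean l"

lemma sqrt_\<sigma>_mult: "sqrt (\<sigma> l) * u * (sqrt (\<sigma> l) * v) = \<sigma> l * (u * v)"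
proof -
  have "sqrt (\<sigma> l) * u * (sqrt (\<sigma> l) * v) = (sqrt (\<sigma> l) * sqrt (\<sigma> l)) * (u * v)"
    by (simp only: mult_ac)
  then show ?thesis by (simp add: \<sigma>_nonneg)
qed

lemma sqrt_k_eq_norm: "x \<in> space M \<Longrightarrow> sqrt (k x x) = norm (Phi x)"
  by (simp add: feature norm_eq_sqrt_inner)

lemma norm_Phi_le: "x \<in> space M \<Longrightarrow> norm (Phi x) \<le> \<kappa>"
  unfolding \<kappa>_def using cSUP_upper[OF _ bounded] by (simp flip: sqrt_k_eq_norm)

lemma \<kappa>_nonneg: "0 \<le> \<kappa>"
  using norm_Phi_le not_empty by (meson all_not_in_conv norm_ge_zero order_trans)

lemma abs_inner_Phi_le: "x \<in> space M \<Longrightarrow> \<bar>h \<bullet> Phi x\<bar> \<le> norm h * \<kappa>"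
  by (meson Cauchy_Schwarz_ineq2 mult_left_mono norm_Phi_le norm_ge_zero order_trans)

lemma integrable_inner_Phi: "integrable M (\<lambda>x. h \<bullet> Phi x)"
  by (rule integrable_const_bound[where B = "norm h * \<kappa>"])
    (auto intro!: AE_I2 abs_inner_Phi_le meas_H)

lemma diag_sums: "x \<in> space M \<Longrightarrow> (\<lambda>j. \<sigma> j * (e j x)\<^sup>2) sums k x x"
  using mercer[of x x] by (simp add: power2_eq_square mult.assoc)

lemma tail_sums:
  assumes "x \<in> space M"
  shows "(\<lambda>j. \<sigma> (j + d) * (e (j + d) x)\<^sup>2) sums (tail x)\<^sup>2"
proof -
  have s: "summable (\<lambda>j. \<sigma> (j + d) * (e (j + d) x)\<^sup>2)"
    using diag_sums[OF assms] by (subst summable_iff_shift) (simp add: sums_iff)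
  then have "(tail x)\<^sup>2 = (\<Sum>j. \<sigma> (j + d) * (e (j + d) x)\<^sup>2)"
    unfolding tail_def by (intro real_sqrt_pow2 suminf_nonneg) (auto simp: \<sigma>_nonneg)
  then show ?thesis using s by (simp add: summable_sums)
qed

lemma tail_nonneg: "x \<in> space M \<Longrightarrow> 0 \<le> tail x"
  using tail_sums[of x] unfolding tail_def
  by (intro real_sqrt_ge_zero suminf_nonneg) (auto simp: sums_iff \<sigma>_nonneg)

text \<open>Splitting the diagonal Mercer series after \<open>d\<close> terms shows that collapsing
  the remaining coordinates to their norm loses none of the squared norm, so \<open>coord x\<close>
  is as long as \<open>Phi x\<close>.\<close>

lemma dot_coord:
  assumes "x \<in> space M"
  shows "dot (Suc d) (coord x) (coord x) = k x x"
proof -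
  have "(\<lambda>j. \<sigma> j * (e j x)\<^sup>2) sums ((tail x)\<^sup>2 + (\<Sum>j<d. \<sigma> j * (e j x)\<^sup>2))"
    using tail_sums[OF assms] sums_iff_shift[of "\<lambda>j. \<sigma> j * (e j x)\<^sup>2" d] by blast
  then have "k x x = (tail x)\<^sup>2 + (\<Sum>j<d. \<sigma> j * (e j x)\<^sup>2)"
    using diag_sums[OF assms] sums_unique2 by blast
  then show ?thesis by (simp add: dot_def coord_def sqrt_\<sigma>_mult power2_eq_square)
qed

lemma dot_coord_le: "x \<in> space M \<Longrightarrow> dot (Suc d) (coord x) (coord x) \<le> \<kappa>\<^sup>2"
  using norm_Phi_le[of x] by (simp add: dot_coord feature power_mono flip: power2_norm_eq_inner)

lemma coord_measurable [measurable]: "(\<lambda>x. coord x l) \<in> borel_measurable M"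
  unfolding coord_def tail_def by measurable

lemma abs_coord_le:
  assumes "x \<in> space M" "l < Suc d"
  shows "\<bar>coord x l\<bar> \<le> \<kappa>"
proof -
  have "(coord x l)\<^sup>2 \<le> dot (Suc d) (coord x) (coord x)"
    unfolding dot_def power2_eq_square using assms(2) by (intro member_le_sum) auto
  also note dot_coord_le[OF assms(1)]
  finally show ?thesis using \<kappa>_nonneg by (simp add: abs_le_square_iff[symmetric])
qed

lemma integrable_coord: "l < Suc d \<Longrightarrow> integrable M (\<lambda>x. coord x l)"
  by (rule integrable_const_bound[where B = \<kappa>]) (auto intro!: AE_I2 abs_coord_le)

lemma dot_ccoord_le:
  assumes "x \<in> space M"
  shows "dot (Suc d) (ccoord x) (ccoord x) \<le> (2 * \<kappa>)\<^sup>2"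
proof -
  let ?m = "sqrt (dot (Suc d) cmean cmean)"
  have bnd: "\<bar>dot (Suc d) cmean (coord x)\<bar> \<le> ?m * \<kappa>" if "x \<in> space M" for x
  proof -
    have "\<bar>dot (Suc d) cmean (coord x)\<bar> \<le> ?m * sqrt (dot (Suc d) (coord x) (coord x))"
      by (rule abs_dot_le)
    also have "\<dots> \<le> ?m * \<kappa>"
      using dot_coord_le[OF that] \<kappa>_nonneg by (intro mult_left_mono real_le_lsqrt) (auto simp: dot_self_nonneg)
    finally show ?thesis .
  qed
  have int: "integrable M (\<lambda>x. dot (Suc d) cmean (coord x))"
    unfolding dot_def by (intro Bochner_Integration.integrable_sum integrable_mult_right integrable_coord) simp
  \<comment> \<open>The mean vector paired with itself is the mean of its pairing with
    \<open>coord x\<close>, so Cauchy-Schwarz gives \<open>?m \<le> \<kappa>\<close>. Centring then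
    at most doubles the radius.\<close>
  have "?m * ?m = dot (Suc d) cmean cmean" by (simp add: dot_self_nonneg)
  also have "\<dots> = (\<integral>x. dot (Suc d) cmean (coord x) \<partial>M)"
    unfolding dot_def using integrable_coord
    by (subst Bochner_Integration.integral_sum) (auto simp: cmean_def)
  also have "\<dots> \<le> (\<integral>x. ?m * \<kappa> \<partial>M)"
    using int bnd by (intro integral_mono) (auto simp: abs_le_iff)
  finally have "?m * ?m \<le> ?m * \<kappa>" by (simp add: prob_space)
  moreover have "0 \<le> ?m" by (simp add: dot_self_nonneg)
  ultimately have m: "?m \<le> \<kappa>"
    using \<kappa>_nonneg mult_le_cancel_left_pos[of ?m ?m \<kappa>] by (cases "?m = 0") linarith+
  have "dot (Suc d) (ccoord x) (ccoord x)
      = dot (Suc d) (coord x) (coord x) - 2 * dot (Suc d) cmean (coord x) + dot (Suc d) cmean cmean"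
    unfolding ccoord_def dot_def sum_subtractf[symmetric] sum_distrib_left sum.distrib[symmetric]
    by (intro sum.cong refl) (simp add: algebra_simps)
  also have "\<dots> \<le> \<kappa>\<^sup>2 + 2 * (\<kappa> * \<kappa>) + \<kappa>\<^sup>2"
  proof -
    have "dot (Suc d) cmean cmean = ?m\<^sup>2" by (simp add: dot_self_nonneg)
    also have "\<dots> \<le> \<kappa>\<^sup>2" using m by (intro power_mono) (auto simp: dot_self_nonneg)
    finally have 1: "dot (Suc d) cmean cmean \<le> \<kappa>\<^sup>2" .
    have 2: "\<bar>dot (Suc d) cmean (coord x)\<bar> \<le> \<kappa> * \<kappa>"
      using bnd[OF assms] m \<kappa>_nonneg by (meson mult_right_mono order_trans)
    show ?thesis using 1 2 dot_coord_le[OF assms] by linarith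
  qed
  also have "\<dots> = (2 * \<kappa>)\<^sup>2" by (simp add: power2_eq_square)
  finally show ?thesis .
qed

lemma ccoord_measurable [measurable]: "(\<lambda>x. ccoord x l) \<in> borel_measurable M"
  unfolding ccoord_def by measurable

lemma integral_ccoord: "l < Suc d \<Longrightarrow> (\<integral>x. ccoord x l \<partial>M) = 0"
  unfolding ccoord_def using integrable_coord by (simp add: cmean_def prob_space)

text \<open>Termwise integration of the tail series, each \<open>e j\<close> having unit norm;
  \<open>\<kappa>\<^sup>2\<close> dominates the partial sums. Summability of the
  \<open>\<sigma> (j + d)\<close> comes out as well.\<close>

lemma \<sigma>_tail_sums: "(\<lambda>j. \<sigma> (j + d)) sums (\<integral>x. (tail x)\<^sup>2 \<partial>M)"
proof -
  have [measurable]: "tail \<in> borel_measurable M" unfolding tail_def by measurable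
  define s where "s n x = (\<Sum>j<n. \<sigma> (j + d) * (e (j + d) x)\<^sup>2)" for n x
  have "(\<lambda>n. \<integral>x. s n x \<partial>M) \<longlonglongrightarrow> (\<integral>x. (tail x)\<^sup>2 \<partial>M)"
  proof (rule integral_dominated_convergence[where w = "\<lambda>_. \<kappa>\<^sup>2"])
    show "AE x in M. (\<lambda>n. s n x) \<longlonglongrightarrow> (tail x)\<^sup>2"
      using tail_sums by (auto simp: s_def sums_def)
    show "AE x in M. norm (s n x) \<le> \<kappa>\<^sup>2" for n
    proof (rule AE_I2)
      fix x assume x: "x \<in> space M"
      have "s n x \<le> (tail x)\<^sup>2"
        using sum_le_suminf[of "\<lambda>j. \<sigma> (j + d) * (e (j + d) x)\<^sup>2" "{..<n}"] tail_sums[OF x]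
        by (simp add: s_def sums_iff \<sigma>_nonneg)
      also have "\<dots> = \<bar>coord x d\<bar>\<^sup>2" by (simp add: coord_def)
      also have "\<dots> \<le> \<kappa>\<^sup>2" using abs_coord_le[OF x, of d] by (intro power_mono) auto
      finally show "norm (s n x) \<le> \<kappa>\<^sup>2" by (simp add: s_def sum_nonneg \<sigma>_nonneg)
    qed
  qed (auto simp: s_def)
  moreover have "(\<integral>x. s n x \<partial>M) = (\<Sum>j<n. \<sigma> (j + d))" for n
    unfolding s_def using e_L2 by (subst Bochner_Integration.integral_sum) (auto simp: e_norm)
  ultimately show ?thesis by (simp add: sums_def)
qed

text \<open>Nonnegative variance of \<open>tail\<close> bounds its mean by the root of its second
  moment.\<close>

lemma cmean_tail_le: "0 \<le> cmean d" "cmean d \<le> sqrt (\<Sum>j. \<sigma> (j + d))"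
proof -
  have [measurable]: "tail \<in> borel_measurable M" unfolding tail_def by measurable
  have ct: "cmean d = (\<integral>x. tail x \<partial>M)" by (simp add: cmean_def coord_def)
  show "0 \<le> cmean d" unfolding ct using tail_nonneg by (intro Bochner_Integration.integral_nonneg)
  have int: "integrable M tail" using integrable_coord[of d] by (simp add: coord_def)
  have "\<bar>tail x\<bar> \<le> \<kappa>" if "x \<in> space M" for x
    using abs_coord_le[OF that, of d] by (simp add: coord_def)
  then have int2: "integrable M (\<lambda>x. (tail x)\<^sup>2)"
    by (intro integrable_const_bound[where B = "\<kappa>\<^sup>2"] AE_I2)
      (auto simp: abs_le_square_iff[symmetric] \<kappa>_nonneg)
  have "0 \<le> (\<integral>x. (tail x - cmean d)\<^sup>2 \<partial>M)" by simp
  also have "\<dots> = (\<integral>x. (tail x)\<^sup>2 \<partial>M) - (cmean d)\<^sup>2"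
    unfolding ct using variance_eq[OF int int2] by simp
  finally show "cmean d \<le> sqrt (\<Sum>j. \<sigma> (j + d))"
    using \<sigma>_tail_sums by (intro real_le_rsqrt) (simp add: sums_iff)
qed

section \<open>From Mercer coordinates to the quadrature error\<close>

lemma span_coefficients:
  assumes "h \<in> span (Phi ` space M)"
  shows "\<exists>b. (\<forall>x\<in>space M. (\<lambda>j. \<sigma> j * e j x * b j) sums (h \<bullet> Phi x)) \<and>
             (\<lambda>j. \<sigma> j * (b j)\<^sup>2) sums (norm h)\<^sup>2"
proof -
  obtain t c where t: "finite t" "t \<subseteq> Phi ` space M" and h: "h = (\<Sum>a\<in>t. c a *\<^sub>R a)"
    using assms unfolding span_explicit by blast
  obtain y where y: "\<And>a. a \<in> t \<Longrightarrow> y a \<in> space M \<and> a = Phi (y a)"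
    using t(2) by (metis image_iff subsetD)
  \<comment> \<open>On the span \<open>h\<close> is a finite combination of kernel sections, so its
    coefficients \<open>b\<close> are explicit and Parseval's identity needs only finite sums of
    Mercer series.\<close>
  define b where "b j = (\<Sum>a\<in>t. c a * e j (y a))" for j
  have s: "(\<lambda>j. \<sigma> j * e j x * b j) sums (h \<bullet> Phi x)" if x: "x \<in> space M" for x
  proof -
    have "(\<lambda>j. \<Sum>a\<in>t. c a * (\<sigma> j * e j x * e j (y a))) sums (\<Sum>a\<in>t. c a * k x (y a))"
      using x y by (intro sums_sum sums_mult mercer) auto
    moreover have "(\<Sum>a\<in>t. c a * k x (y a)) = h \<bullet> Phi x"
      unfolding h inner_sum_left using x y by (intro sum.cong) (auto simp: feature inner_commute)
    ultimately show ?thesis by (simp add: b_def sum_distrib_left mult_ac)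
  qed
  have "(\<lambda>j. \<Sum>a\<in>t. c a * (\<sigma> j * e j (y a) * b j)) sums (\<Sum>a\<in>t. c a * (h \<bullet> Phi (y a)))"
    using y by (intro sums_sum sums_mult s) auto
  moreover have "(\<Sum>a\<in>t. c a * (h \<bullet> Phi (y a))) = (\<Sum>a\<in>t. h \<bullet> (c a *\<^sub>R a))"
    using y by (intro sum.cong) auto
  then have "(\<Sum>a\<in>t. c a * (h \<bullet> Phi (y a))) = (norm h)\<^sup>2"
    unfolding inner_sum_right[symmetric] h[symmetric] power2_norm_eq_inner .
  moreover have "(\<Sum>a\<in>t. c a * (\<sigma> j * e j (y a) * b j)) = \<sigma> j * (b j)\<^sup>2" for j
  proof -
    have "(\<Sum>a\<in>t. c a * (\<sigma> j * e j (y a) * b j)) = \<sigma> j * b j * (\<Sum>a\<in>t. c a * e j (y a))"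
      by (simp add: sum_distrib_left mult_ac)
    then show ?thesis by (simp add: b_def[symmetric] power2_eq_square)
  qed
  ultimately show ?thesis using s by (intro exI[of _ b]) simp
qed

text \<open>Beyond the first \<open>d\<close> coordinates \<open>h\<close> contributes
  \<open>g\<close>, with \<open>\<bar>g x\<bar> \<le> \<beta> * tail x\<close>. Its integral costs
  at most \<open>\<beta> * cmean d\<close> and its weighted sum at most
  \<open>\<beta> * (cmean d + \<bar>r d\<bar>)\<close>: hence the factor 2. All terms in
  \<open>r\<close> are then collected by one Cauchy-Schwarz inequality.\<close>

lemma quadrature_error_span:
  assumes h: "h \<in> span (Phi ` space M)"
    and w: "w \<in> simplex_weights {..<N}" and xs: "\<And>i. i < N \<Longrightarrow> xs i \<in> space M"
  defines "r \<equiv> comb (\<lambda>i. ccoord (xs i)) {..<N} w"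
  shows "\<bar>(\<integral>x. h \<bullet> Phi x \<partial>M) - (\<Sum>i<N. w i * (h \<bullet> Phi (xs i)))\<bar>
    \<le> norm h * (2 * sqrt (\<Sum>j. \<sigma> (j + d)) + sqrt (dot (Suc d) r r))"
proof -
  obtain b where b: "\<And>x. x \<in> space M \<Longrightarrow> (\<lambda>j. \<sigma> j * e j x * b j) sums (h \<bullet> Phi x)"
    and nb: "(\<lambda>j. \<sigma> j * (b j)\<^sup>2) sums (norm h)\<^sup>2"
    using span_coefficients[OF h] by blast
  define \<beta>2 where "\<beta>2 = (\<Sum>j. \<sigma> (j + d) * (b (j + d))\<^sup>2)"
  define \<beta> where "\<beta> = sqrt \<beta>2"
  have \<beta>s: "(\<lambda>j. \<sigma> (j + d) * (b (j + d))\<^sup>2) sums \<beta>2"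
    unfolding \<beta>2_def using nb
    by (intro summable_sums) (subst summable_iff_shift, simp add: sums_iff)
  have \<beta>2: "0 \<le> \<beta>2" using \<beta>s by (auto simp: sums_iff \<beta>2_def \<sigma>_nonneg intro!: suminf_nonneg)
  have nh: "(norm h)\<^sup>2 = \<beta>2 + (\<Sum>j<d. \<sigma> j * (b j)\<^sup>2)"
    using nb \<beta>s sums_iff_shift[of "\<lambda>j. \<sigma> j * (b j)\<^sup>2" d \<beta>2] sums_unique2 by blast
  define g where "g x = h \<bullet> Phi x - (\<Sum>l<d. sqrt (\<sigma> l) * b l * coord x l)" for x
  have g: "\<bar>g x\<bar> \<le> \<beta> * coord x d" if x: "x \<in> space M" for x
  proof -
    have "(\<Sum>l<d. sqrt (\<sigma> l) * b l * coord x l) = (\<Sum>l<d. \<sigma> l * e l x * b l)"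
      by (intro sum.cong refl) (simp add: coord_def sqrt_\<sigma>_mult)
    then have "(\<lambda>j. \<sigma> (j + d) * e (j + d) x * b (j + d)) sums g x"
      using b[OF x] sums_iff_shift[of "\<lambda>j. \<sigma> j * e j x * b j" d "g x"] by (simp add: g_def)
    then have "(\<lambda>j. (sqrt (\<sigma> (j + d)) * e (j + d) x) * (sqrt (\<sigma> (j + d)) * b (j + d))) sums g x"
      unfolding sqrt_\<sigma>_mult by (simp add: mult.assoc)
    moreover have "(\<lambda>j. (sqrt (\<sigma> (j + d)) * e (j + d) x)\<^sup>2) sums (tail x)\<^sup>2"
      using tail_sums[OF x] by (simp add: power_mult_distrib \<sigma>_nonneg)
    moreover have "(\<lambda>j. (sqrt (\<sigma> (j + d)) * b (j + d))\<^sup>2) sums \<beta>2"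
      using \<beta>s by (simp add: power_mult_distrib \<sigma>_nonneg)
    ultimately have "\<bar>g x\<bar> \<le> sqrt ((tail x)\<^sup>2) * sqrt \<beta>2" by (intro sums_Cauchy_Schwarz)
    then show ?thesis using tail_nonneg[OF x] by (simp add: coord_def \<beta>_def mult.commute)
  qed
  have intg: "integrable M g"
    unfolding g_def
    by (intro Bochner_Integration.integrable_diff integrable_inner_Phi Bochner_Integration.integrable_sum
        integrable_mult_right integrable_coord) simp
  have w0: "0 \<le> w i" if "i < N" for i using w that by (simp add: simplex_weights_def)
  have w1: "(\<Sum>i<N. w i) = 1" using w by (simp add: simplex_weights_def)
  have r: "r l = (\<Sum>i<N. w i * coord (xs i) l) - cmean l" for l
    by (simp add: r_def comb_def ccoord_def right_diff_distrib sum_subtractf sum_distrib_right[symmetric] w1)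
  \<comment> \<open>Placing \<open>\<beta>\<close> at index \<open>d\<close> matches the tail
    coordinate of \<open>r\<close> and makes the norm of \<open>a\<close> exactly
    \<open>norm h\<close>.\<close>
  define a where "a l = (if l < d then sqrt (\<sigma> l) * \<bar>b l\<bar> else \<beta>)" for l
  have aa: "dot (Suc d) a a = (norm h)\<^sup>2"
  proof -
    have "(\<Sum>l<d. a l * a l) = (\<Sum>l<d. \<sigma> l * (b l)\<^sup>2)"
      by (intro sum.cong refl) (simp add: a_def sqrt_\<sigma>_mult power2_eq_square)
    then show ?thesis using \<beta>2 by (simp add: dot_def nh a_def \<beta>_def)
  qed
  have "(\<integral>x. h \<bullet> Phi x \<partial>M) = (\<integral>x. g x + (\<Sum>l<d. sqrt (\<sigma> l) * b l * coord x l) \<partial>M)"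
    by (simp add: g_def)
  also have "\<dots> = (\<integral>x. g x \<partial>M) + (\<Sum>l<d. sqrt (\<sigma> l) * b l * cmean l)"
  proof -
    have c: "integrable M (\<lambda>x. sqrt (\<sigma> l) * b l * coord x l)" if "l \<in> {..<d}" for l
      using that by (intro integrable_mult_right integrable_coord) simp
    then have "integrable M (\<lambda>x. \<Sum>l<d. sqrt (\<sigma> l) * b l * coord x l)"
      by (rule Bochner_Integration.integrable_sum)
    moreover have "(\<integral>x. (\<Sum>l<d. sqrt (\<sigma> l) * b l * coord x l) \<partial>M)
        = (\<Sum>l<d. \<integral>x. sqrt (\<sigma> l) * b l * coord x l \<partial>M)"
      by (rule Bochner_Integration.integral_sum) (rule c)
    ultimately show ?thesis by (simp add: Bochner_Integration.integral_add[OF intg] cmean_def)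
  qed
  finally have I: "(\<integral>x. h \<bullet> Phi x \<partial>M) = (\<integral>x. g x \<partial>M) + (\<Sum>l<d. sqrt (\<sigma> l) * b l * cmean l)" .
  have "(\<Sum>i<N. w i * (h \<bullet> Phi (xs i))) = (\<Sum>i<N. w i * g (xs i)) + (\<Sum>i<N. \<Sum>l<d. w i * (sqrt (\<sigma> l) * b l * coord (xs i) l))"
    by (simp add: g_def right_diff_distrib sum_subtractf sum_distrib_left)
  also have "(\<Sum>i<N. \<Sum>l<d. w i * (sqrt (\<sigma> l) * b l * coord (xs i) l))
      = (\<Sum>l<d. sqrt (\<sigma> l) * b l * (\<Sum>i<N. w i * coord (xs i) l))"
    by (subst sum.swap) (simp add: sum_distrib_left mult_ac)
  finally have "(\<integral>x. h \<bullet> Phi x \<partial>M) - (\<Sum>i<N. w i * (h \<bullet> Phi (xs i)))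
      = (\<integral>x. g x \<partial>M) - (\<Sum>i<N. w i * g (xs i)) - (\<Sum>l<d. sqrt (\<sigma> l) * b l * r l)"
    unfolding I r by (simp add: right_diff_distrib sum_subtractf)
  moreover have "\<bar>\<integral>x. g x \<partial>M\<bar> \<le> \<beta> * cmean d"
  proof -
    have "\<bar>\<integral>x. g x \<partial>M\<bar> \<le> (\<integral>x. \<beta> * coord x d \<partial>M)"
      using g intg integrable_coord[of d] by (intro integral_abs_bound[THEN order_trans] integral_mono) auto
    then show ?thesis by (simp add: cmean_def)
  qed
  moreover have "\<bar>\<Sum>i<N. w i * g (xs i)\<bar> \<le> \<beta> * (cmean d + \<bar>r d\<bar>)"
  proof -
    have "\<bar>\<Sum>i<N. w i * g (xs i)\<bar> \<le> (\<Sum>i<N. w i * (\<beta> * coord (xs i) d))"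
      using g xs w0 by (intro sum_abs[THEN order_trans] sum_mono) (auto simp: abs_mult intro!: mult_left_mono)
    \<comment> \<open>Here the extra coordinate pays off: the weighted average of the tail norms is
      \<open>cmean d + r d\<close>.\<close>
    also have "\<dots> = \<beta> * (cmean d + r d)"
      by (simp add: r sum_distrib_left mult_ac)
    also have "\<dots> \<le> \<beta> * (cmean d + \<bar>r d\<bar>)" using \<beta>2 by (intro mult_left_mono) (auto simp: \<beta>_def)
    finally show ?thesis .
  qed
  moreover have "\<bar>\<Sum>l<d. sqrt (\<sigma> l) * b l * r l\<bar> \<le> (\<Sum>l<d. a l * \<bar>r l\<bar>)"
    by (intro sum_abs[THEN order_trans] sum_mono) (simp add: a_def abs_mult \<sigma>_nonneg)
  moreover have "(\<Sum>l<d. a l * \<bar>r l\<bar>) + \<beta> * \<bar>r d\<bar> = dot (Suc d) a (\<lambda>l. \<bar>r l\<bar>)"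
    by (simp add: dot_def a_def)
  moreover have "dot (Suc d) a (\<lambda>l. \<bar>r l\<bar>) \<le> norm h * sqrt (dot (Suc d) r r)"
  proof -
    have "dot (Suc d) (\<lambda>l. \<bar>r l\<bar>) (\<lambda>l. \<bar>r l\<bar>) = dot (Suc d) r r" by (simp add: dot_def)
    then show ?thesis using abs_dot_le[of "Suc d" a "\<lambda>l. \<bar>r l\<bar>"] by (simp add: aa)
  qed
  moreover have "\<beta> * cmean d \<le> norm h * sqrt (\<Sum>j. \<sigma> (j + d))"
  proof (rule mult_mono)
    have "\<beta>2 \<le> (norm h)\<^sup>2" by (simp add: nh sum_nonneg \<sigma>_nonneg)
    then show "\<beta> \<le> norm h" unfolding \<beta>_def by (intro real_le_lsqrt) (auto simp: \<beta>2)
  qed (use cmean_tail_le in auto)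
  ultimately show ?thesis by (simp add: algebra_simps)
qed

text \<open>A crude bound, valid for all \<open>h\<close>: it gives the continuity used to pass from
  the span to its closure, and it handles small \<open>n\<close>.\<close>

lemma quadrature_error_le:
  assumes w: "w \<in> simplex_weights {..<N}" and xs: "\<And>i. i < N \<Longrightarrow> xs i \<in> space M"
  shows "\<bar>(\<integral>x. h \<bullet> Phi x \<partial>M) - (\<Sum>i<N. w i * (h \<bullet> Phi (xs i)))\<bar> \<le> norm h * (2 * \<kappa>)"
proof -
  have w0: "0 \<le> w i" if "i < N" for i using w that by (simp add: simplex_weights_def)
  have w1: "(\<Sum>i<N. w i) = 1" using w by (simp add: simplex_weights_def)
  have "\<bar>\<integral>x. h \<bullet> Phi x \<partial>M\<bar> \<le> (\<integral>x. norm h * \<kappa> \<partial>M)"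
    using abs_inner_Phi_le integrable_inner_Phi
    by (intro integral_abs_bound[THEN order_trans] integral_mono) auto
  moreover have "\<bar>\<Sum>i<N. w i * (h \<bullet> Phi (xs i))\<bar> \<le> (\<Sum>i<N. w i * (norm h * \<kappa>))"
    using abs_inner_Phi_le xs w0
    by (intro sum_abs[THEN order_trans] sum_mono) (auto simp: abs_mult intro!: mult_left_mono)
  ultimately show ?thesis by (simp add: prob_space w1 flip: sum_distrib_right)
qed

text \<open>The error is a linear functional of \<open>h\<close>, bounded by
  \<open>quadrature_error_le\<close>, so an estimate on the dense span passes to the limit.\<close>

lemma wce_le:
  assumes w: "w \<in> simplex_weights {..<N}" and xs: "\<And>i. i < N \<Longrightarrow> xs i \<in> space M"
    and C: "\<And>h. h \<in> span (Phi ` space M) \<Longrightarrow>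
      \<bar>(\<integral>x. h \<bullet> Phi x \<partial>M) - (\<Sum>i<N. w i * (h \<bullet> Phi (xs i)))\<bar> \<le> norm h * C"
    and C0: "0 \<le> C"
  shows "wce M Phi N xs w \<le> C"
proof -
  define E where "E h = (\<integral>x. h \<bullet> Phi x \<partial>M) - (\<Sum>i<N. w i * (h \<bullet> Phi (xs i)))" for h
  have E_diff: "E h - E g = E (h - g)" for h g
    by (simp add: E_def inner_diff_left integrable_inner_Phi right_diff_distrib sum_subtractf)
  have E_le: "\<bar>E h\<bar> \<le> norm h * (2 * \<kappa>)" for h
    unfolding E_def by (rule quadrature_error_le[OF w xs])
  have all: "\<bar>E h\<bar> \<le> norm h * C" for h
  proof -
    have "h \<in> closure (span (Phi ` space M))" by (simp add: dense)
    then obtain g where g: "\<And>n. g n \<in> span (Phi ` space M)" "g \<longlonglongrightarrow> h"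
      unfolding closure_sequential by blast
    have lim0: "(\<lambda>n. norm (h - g n) * (2 * \<kappa>)) \<longlonglongrightarrow> 0"
      using tendsto_mult_left_zero[OF tendsto_norm_zero[OF LIM_zero[OF g(2)]], of "2 * \<kappa>"]
      by (simp add: norm_minus_commute)
    have "(\<lambda>n. norm (g n) * C + norm (h - g n) * (2 * \<kappa>)) \<longlonglongrightarrow> norm h * C + 0"
      by (intro tendsto_add tendsto_mult tendsto_norm g(2) tendsto_const lim0)
    moreover have "\<bar>E h\<bar> \<le> norm (g n) * C + norm (h - g n) * (2 * \<kappa>)" for n
      using C[OF g(1), of n, folded E_def] E_le[of "h - g n"] E_diff[of h "g n"] by linarith
    ultimately show ?thesis by (intro LIMSEQ_le_const) auto
  qed
  show ?thesis
    unfolding wce_def E_def[symmetric]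
  proof (rule cSUP_least)
    show "{h :: 'h. norm h \<le> 1} \<noteq> {}" by (auto intro: exI[of _ 0])
    fix h :: 'h assume "h \<in> {h. norm h \<le> 1}"
    then have "norm h * C \<le> 1 * C" using C0 by (intro mult_right_mono) auto
    then show "\<bar>E h\<bar> \<le> C" using all[of h] by simp
  qed
qed

section \<open>Assembling the bounds\<close>

lemma exists_good_weights:
  assumes N: "0 < N" and xs: "xs \<in> space (PiM {..<N} (\<lambda>_. M))" and \<eta>: "0 \<le> \<eta>"
    and dist: "hull_dist2 (Suc d) (\<lambda>i. ccoord (xs i)) {..<N} \<le> \<eta>\<^sup>2"
  shows "\<exists>w\<in>prob_simplex N. wce M Phi N xs w \<le> 2 * sqrt (\<Sum>j. \<sigma> (j + d)) + \<eta>"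
proof -
  have xs': "xs i \<in> space M" if "i < N" for i using xs that by (auto simp: space_PiM)
  obtain w where w: "nearest_weights (Suc d) (\<lambda>i. ccoord (xs i)) {..<N} w"
    using nearest_weights_exist[of "{..<N}"] N by auto
  then have ws: "w \<in> simplex_weights {..<N}" by (simp add: nearest_weights_def)
  let ?r = "comb (\<lambda>i. ccoord (xs i)) {..<N} w"
  have T: "0 \<le> sqrt (\<Sum>j. \<sigma> (j + d))" using cmean_tail_le by linarith
  have r: "sqrt (dot (Suc d) ?r ?r) \<le> \<eta>"
    using w dist \<eta> by (intro real_le_lsqrt) (auto simp: nearest_weights_def dot_self_nonneg)
  have "wce M Phi N xs w \<le> 2 * sqrt (\<Sum>j. \<sigma> (j + d)) + \<eta>"
  proof (rule wce_le[OF ws xs'])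
    fix h assume "h \<in> span (Phi ` space M)"
    note quadrature_error_span[OF this ws xs']
    also have "norm h * (2 * sqrt (\<Sum>j. \<sigma> (j + d)) + sqrt (dot (Suc d) ?r ?r))
        \<le> norm h * (2 * sqrt (\<Sum>j. \<sigma> (j + d)) + \<eta>)"
      using r by (intro mult_left_mono) auto
    finally show "\<bar>(\<integral>x. h \<bullet> Phi x \<partial>M) - (\<Sum>i<N. w i * (h \<bullet> Phi (xs i)))\<bar>
        \<le> norm h * (2 * sqrt (\<Sum>j. \<sigma> (j + d)) + \<eta>)" .
  qed (use T \<eta> in auto)
  then show ?thesis using ws by (auto simp: prob_simplex_def simplex_weights_def)
qed

text \<open>Putting all weight on one sample point suffices whenever \<open>2 * \<kappa>\<close> is
  at most the claimed error.\<close>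

lemma exists_weights_trivial:
  assumes N: "0 < N" and xs: "xs \<in> space (PiM {..<N} (\<lambda>_. M))"
  shows "\<exists>w\<in>prob_simplex N. wce M Phi N xs w \<le> 2 * \<kappa>"
proof -
  have xs': "xs i \<in> space M" if "i < N" for i using xs that by (auto simp: space_PiM)
  define w :: "nat \<Rightarrow> real" where "w = (\<lambda>j. if j = 0 then 1 else 0)"
  have ws: "w \<in> simplex_weights {..<N}" unfolding w_def using N by (intro unit_weight_mem) auto
  have "wce M Phi N xs w \<le> 2 * \<kappa>"
    using wce_le[OF ws xs'] quadrature_error_le[OF ws xs'] \<kappa>_nonneg by simp
  then show ?thesis using ws by (auto simp: prob_simplex_def simplex_weights_def)
qed

text \<open>With \<open>k = 2 * Suc d\<close> ghost points and \<open>q = 1/3\<close> the failure probability is at most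
  \<open>(27/64) ^ Suc d\<close>.\<close>

lemma ccoord_hull_miss_prob_le:
  assumes n: "3 \<le> n" and N: "6 * Suc d * n \<le> N" and \<kappa>: "0 < \<kappa>"
  shows "measure (PiM {..<N} (\<lambda>_. M)) {xs\<in>space (PiM {..<N} (\<lambda>_. M)).
      (4 * \<kappa> / real n)\<^sup>2 < hull_dist2 (Suc d) (\<lambda>i. ccoord (xs i)) {..<N}} \<le> (1/2) ^ Suc d"
    (is "?p \<le> _")
proof -
  let ?\<eta> = "4 * \<kappa> / real n"
  let ?\<alpha> = "?\<eta> / (2 * \<kappa> + ?\<eta>)"
  define m where "m = 2 * Suc d"
  have N0: "0 < N" using N n by (metis gr0I mult_is_0 le_zero_eq not_numeral_le_zero zero_neq_numeral nat.distinct(1))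
  have m: "0 < m" by (simp add: m_def)
  have "2 * \<kappa> + ?\<eta> = 2 * \<kappa> * (real n + 2) / real n" using n by (simp add: field_simps)
  then have \<alpha>: "?\<alpha> = 2 / (real n + 2)" using \<kappa> n by (simp add: frac_eq_eq)
  have "real (6 * Suc d * n) \<le> real N" using N by (rule of_nat_mono)
  then have "3 * real n * real m \<le> real N" by (simp add: m_def algebra_simps)
  then have "(3 * real n + 1) * real m \<le> real (N + m)" by (simp add: algebra_simps)
  then have r: "3 * real n + 1 \<le> real (N + m) / real m" using m by (simp add: pos_le_divide_eq)
  \<comment> \<open>This is \<open>4 * (n + 2) \<le> 2 * (3 * n + 1)\<close>, that is
    \<open>n \<ge> 3\<close>. Smaller \<open>n\<close> are covered by the trivial bound.\<close>
  have "4 \<le> ?\<alpha> * (3 * real n + 1)" unfolding \<alpha> using n by (simp add: pos_le_divide_eq)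
  also have "\<dots> \<le> ?\<alpha> * (real (N + m) / real m)" using r \<kappa> by (intro mult_left_mono) auto
  finally have "4 ^ m \<le> (?\<alpha> * (real (N + m) / real m)) ^ m" by (intro power_mono) auto
  also have "\<dots> = ?\<alpha> ^ m * (real (N + m) / real m) ^ m" by (rule power_mult_distrib)
  also have "\<dots> \<le> ?\<alpha> ^ m * real ((N + m) choose m)"
    using \<kappa> by (intro mult_left_mono binomial_ge_n_over_k_pow_k) auto
  finally have "16 ^ Suc d \<le> ?\<alpha> ^ m * real ((N + m) choose m)" by (simp add: m_def power_mult)
  \<comment> \<open>The value \<open>q = 1/3\<close> maximises \<open>q * (1 - q)\<^sup>2\<close> on
    the unit interval. Since \<open>m = 2 * Suc d\<close>, the product is a power of
    \<open>4/27\<close>, and \<open>16 * 4 / 27 = 64/27\<close> exceeds 2.\<close>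
  moreover have "(1/3 :: real) ^ Suc d * (1 - 1/3) ^ m = (4/27) ^ Suc d"
  proof -
    have "(1 - 1/3 :: real) ^ m = (4/9) ^ Suc d"
      unfolding m_def power_mult by (simp add: power2_eq_square del: power_Suc)
    then show ?thesis by (simp add: power_mult_distrib[symmetric] del: power_Suc)
  qed
  moreover have "?p * ?\<alpha> ^ m * real ((N + m) choose m) * ((1/3) ^ Suc d * (1 - 1/3) ^ m) \<le> 1"
    using \<kappa> n N0 dot_ccoord_le integral_ccoord by (intro hull_miss_prob_le) auto
  ultimately have "?p * (?\<alpha> ^ m * real ((N + m) choose m)) * (4/27) ^ Suc d \<le> 1"
    and "16 ^ Suc d \<le> ?\<alpha> ^ m * real ((N + m) choose m)" by (simp_all only: mult.assoc)
  then have "?p * 16 ^ Suc d * (4/27) ^ Suc d \<le> 1"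
    by (meson mult_left_mono mult_right_mono order_trans measure_nonneg zero_le_power divide_nonneg_nonneg zero_le_numeral)
  then have "?p * (64/27) ^ Suc d \<le> 1"
    by (simp add: mult.assoc power_mult_distrib[symmetric] del: power_Suc)
  moreover have "?p * 2 ^ Suc d \<le> ?p * (64/27) ^ Suc d"
    by (intro mult_left_mono power_mono) auto
  ultimately have "?p * 2 ^ Suc d \<le> 1" by linarith
  then show ?thesis by (simp add: power_one_over pos_le_divide_eq)
qed

end

theorem theorem6:
  fixes M :: "'a measure"
    and k :: "'a \<Rightarrow> 'a \<Rightarrow> real"
    and Phi :: "'a \<Rightarrow> 'h::{real_inner, complete_space}"
    and \<sigma> :: "nat \<Rightarrow> real"
    and e :: "nat \<Rightarrow> 'a \<Rightarrow> real"
    and N d :: nat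
  assumes prob: "prob_space M"
    and feature: "\<forall>x\<in>space M. \<forall>y\<in>space M. k x y = Phi x \<bullet> Phi y"
    and dense: "closure (span (Phi ` space M)) = UNIV"
    and meas_H: "\<forall>h. (\<lambda>x. h \<bullet> Phi x) \<in> borel_measurable M"
    and bounded: "bdd_above ((\<lambda>x. sqrt (k x x)) ` space M)"
    and e_meas: "\<forall>j. e j \<in> borel_measurable M"
    and e_L2: "\<forall>j. integrable M (\<lambda>x. (e j x)^2)"
    and e_orth: "\<forall>i j. (\<integral>x. e i x * e j x \<partial>M) = (if i = j then 1 else 0)"
    and \<sigma>_mono: "antimono \<sigma>"
    and \<sigma>_nonneg: "\<forall>j. 0 \<le> \<sigma> j"
    and mercer: "\<forall>x\<in>space M. \<forall>y\<in>space M. (\<lambda>j. \<sigma> j * e j x * e j y) sums k x y"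
    and d_pos: "0 < d"
    and N_ge: "6 * (d + 1) \<le> N"
  shows "\<exists>A \<in> sets (PiM {..<N} (\<lambda>_. M)).
           A \<subseteq> {xs \<in> space (PiM {..<N} (\<lambda>_. M)).
                  \<exists>w \<in> prob_simplex N.
                    wce M Phi N xs w
                      \<le> 2 * sqrt (\<Sum>j. \<sigma> (j + d))
                        + 4 * (SUP x \<in> space M. sqrt (k x x)) / real (N div (6 * (d + 1)))}
         \<and> measure (PiM {..<N} (\<lambda>_. M)) A \<ge> 1 - (1/2) ^ (d + 1)"
proof -
  interpret mercer_kernel M k Phi \<sigma> e d
  proof (intro mercer_kernel.intro[OF prob] mercer_kernel_axioms.intro)
    show "(\<integral>x. (e j x)\<^sup>2 \<partial>M) = 1" for j using e_orth by (simp add: power2_eq_square)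
  qed (use feature dense meas_H bounded e_meas e_L2 \<sigma>_nonneg mercer in auto)
  let ?P = "PiM {..<N} (\<lambda>_. M)"
  interpret P: prob_space ?P by (rule prob_space_PiM) (rule prob_space_axioms)
  define n where "n = N div (6 * (d + 1))"
  have N0: "0 < N" using N_ge by simp
  have n: "0 < n" unfolding n_def using N_ge by (simp add: div_greater_zero_iff)
  have nN: "6 * Suc d * n \<le> N" unfolding n_def by (metis Suc_eq_plus1 times_div_less_eq_dividend)
  have T: "0 \<le> sqrt (\<Sum>j. \<sigma> (j + d))" using cmean_tail_le by linarith
  let ?good = "{xs \<in> space ?P. \<exists>w \<in> prob_simplex N.
      wce M Phi N xs w \<le> 2 * sqrt (\<Sum>j. \<sigma> (j + d)) + 4 * \<kappa> / real n}"
  have "\<exists>A\<in>sets ?P. A \<subseteq> ?good \<and> measure ?P A \<ge> 1 - (1/2) ^ (d + 1)"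
  \<comment> \<open>For \<open>n \<le> 2\<close> or \<open>\<kappa> = 0\<close> the term
    \<open>4 * \<kappa> / n\<close> is at least \<open>2 * \<kappa>\<close>, and a single sample
    point meets the bound with certainty.\<close>
  proof (cases "3 \<le> n \<and> 0 < \<kappa>")
    case True
    \<comment> \<open>The failure event is phrased through the measurable hull distance; its
      complement is a measurable set of good samples and serves as \<open>A\<close>.\<close>
    define F where "F = {xs\<in>space ?P. (4 * \<kappa> / real n)\<^sup>2 < hull_dist2 (Suc d) (\<lambda>i. ccoord (xs i)) {..<N}}"
    have [measurable]: "(\<lambda>xs. hull_dist2 (Suc d) (\<lambda>i. ccoord (xs i)) {..<N}) \<in> borel_measurable ?P"
      using N0 by (intro borel_measurable_hull_dist2) auto
    have F: "F \<in> sets ?P" unfolding F_def by measurable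
    have "measure ?P F \<le> (1/2) ^ Suc d"
      unfolding F_def using True nN by (intro ccoord_hull_miss_prob_le) auto
    then have "1 - (1/2) ^ (d + 1) \<le> measure ?P (space ?P - F)"
      using P.prob_compl[OF F] by simp
    moreover have "space ?P - F \<subseteq> ?good"
      using exists_good_weights[OF N0, of _ "4 * \<kappa> / real n"] \<kappa>_nonneg by (auto simp: F_def not_less)
    ultimately show ?thesis using F by (intro bexI[of _ "space ?P - F"]) auto
  next
    case False
    then have "2 * \<kappa> \<le> 4 * \<kappa> / real n"
    proof (cases "\<kappa> = 0")
      case False
      then have "n \<le> 2" using \<open>\<not> (3 \<le> n \<and> 0 < \<kappa>)\<close> \<kappa>_nonneg by auto
      then have "2 * \<kappa> * real n \<le> 2 * \<kappa> * 2" using \<kappa>_nonneg by (intro mult_left_mono) auto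
      then show ?thesis using n by (simp add: pos_le_divide_eq)
    qed simp
    then have "space ?P \<subseteq> ?good"
      using exists_weights_trivial[OF N0] T by (fastforce intro: order_trans)
    then show ?thesis by (intro bexI[of _ "space ?P"]) (auto simp: P.prob_space)
  qed
  then show ?thesis by (simp add: n_def \<kappa>_def)
qed

end
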